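(* Consider the finite sum case $f(x)=\frac1n\sum_{i=1}^n f_i(x)$, $f_i(x)=\frac1m\sum_{j=1}^m f_{ij}(x)$, $x\in\mathbb{R}^d$. Assume there exists $f_*\in\mathbb{R}$ with $f(x)\ge f_*$ for all $x\in\mathbb{R}^d$; that $f_i$ is $L_i$-smooth for all $i\in\{1,\dots,n\}$, i.e. $\|\nabla f_i(x)-\nabla f_i(y)\|\le L_i\|x-y\|$ for all $x,y\in\mathbb{R}^d$; that the average $\mathcal{L}$-smoothness assumption (see context) holds with constants $\mathcal{L}_i\ge0$; and that $f$ satisfies the Polyak–Łojasiewicz condition with parameter $\mu$, i.e. $\|\nabla f(x)\|^2\ge2\mu(f(x)-f(x^* ))$ for all $x\in\mathbb{R}^d$, where $x^*=\arg\min_{x\in\mathbb{R}^d}f(x)$. Let $\mathcal{Q}$ be a quantization operator with parameter $\omega$ and expected density $\zeta_{\mathcal Q}$, let $p\in(0,1]$, and let $$\gamma\le\min\left\{\frac{1}{L+\sqrt{\frac{2(1-p)}{pn}\left(\omega L^2+\frac{(1+\omega)\mathcal{L}^2}{b'}\right)}},\frac{p}{2\mu}\right\},$$ where $L^2=\frac1n\sum_{i=1}^nL_i^2$ and $\mathcal{L}^2=\frac1n\sum_{i=1}^n\mathcal{L}_i^2$. Then after $K$ iterations of VR-MARINA (finite sum case) we have $$\mathbf{E}\left[f(x^K)-f(x^* )\right]\le(1-\gamma\mu)^K\Delta_0,$$ where $\Delta_0=f(x^0)-f(x^* )$. That is, after $$K=\mathcal{O}\left(\max\left\{\frac1p,\frac{L+\sqrt{\frac{1-p}{pn}\left(\omega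 L^2+\frac{(1+\omega)\mathcal{L}^2}{b'}\right)}}{\mu}\right\}\log\frac{\Delta_0}{\varepsilon}\right)$$ iterations VR-MARINA produces such a point $x^K$ that $\mathbf{E}[f(x^K)-f(x^* )]\le\varepsilon$, and the expected total number of stochastic oracle calls per node equals $$m+K(pm+2(1-p)b')=\mathcal{O}\left(m+\max\left\{\frac1p,\frac{L+\sqrt{\frac{1-p}{pn}\left(\omega L^2+\frac{(1+\omega)\mathcal{L}^2}{b'}\right)}}{\mu}\right\}(pm+(1-p)b')\log\frac{\Delta_0}{\varepsilon}\right).$$ Moreover, under an assumption that the communication cost is proportional to the number of non-zero components of transmitted vectors from workers to the server, the expected total communication cost per worker equals $$d+K(pd+(1-p)\zeta_{\mathcal Q})=\mathcal{O}\left(d+\max\left\{\frac1p,\frac{L+\sqrt{\frac{1-p}{pn}\left(\omega L^2+\frac{(1+\omega)\mathcal{L}^2}{b'}\right)}}{\mu}\right\}(pd+(1-p)\zeta_{\mathcal Q})\log\frac{\Delta_0}{\varepsilon}\right).$$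
   Context: $\|\cdot\|$ is the Euclidean norm; $\|y\|_0$ is the number of non-zero components of $y\in\mathbb{R}^d$. Quantization operator: a stochastic mapping $\mathcal{Q}:\mathbb{R}^d\to\mathbb{R}^d$ for which there is $\omega>0$ with $\mathbf{E}[\mathcal{Q}(x)]=x$ and $\mathbf{E}[\|\mathcal{Q}(x)-x\|^2]\le\omega\|x\|^2$ for any $x\in\mathbb{R}^d$. Its expected density is $\zeta_{\mathcal Q}=\sup_{x\in\mathbb{R}^d}\mathbf{E}[\|\mathcal{Q}(x)\|_0]$. VR-MARINA, finite sum case (a distributed method with $n$ workers, worker $i$ having access to $f_i$, and a server; input: starting point $x^0$, stepsize $\gamma$, minibatch size $b'$, probability $p\in(0,1]$, number of iterations $K$): initialize $g^0=\nabla f(x^0)$. For $k=0,\dots,K-1$: sample $c_k\sim\mathrm{Bernoulli}(p)$ and broadcast $g^k$ to all workers; each worker $i=1,\dots,n$ in parallel computes $x^{k+1}=x^k-\gamma g^k$ and sets $g_i^{k+1}=\nabla f_i(x^{k+1})$ if $c_k=1$, and $g_i^{k+1}=g^k+\mathcal{Q}(\widetilde\Delta_i^k)$ otherwise, where $\widetilde\Delta_i^k=\frac1{b'}\sum_{j\in I'_{i,k}}(\nabla f_{ij}(x^{k+1})-\nabla f_{ij}(x^k))$ and $I'_{i,k}$ is the set of the indices in the minibatch, $|I'_{i,k}|=b'$; then $g^{k+1}=\frac1n\sum_{i=1}^n g_i^{k+1}$. The point considered here is the last iterate $x^K$. Average $\mathcal{L}$-smoothness: for all $k\ge0$ and $i\in\{1,\dots,n\}$,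 with $\Delta_i^k=\nabla f_i(x^{k+1})-\nabla f_i(x^k)$, one has $\mathbf{E}[\widetilde\Delta_i^k\mid x^k,x^{k+1}]=\Delta_i^k$ and $\mathbf{E}[\|\widetilde\Delta_i^k-\Delta_i^k\|^2\mid x^k,x^{k+1}]\le\frac{\mathcal{L}_i^2}{b'}\|x^{k+1}-x^k\|^2$ with some $\mathcal{L}_i\ge0$. A stochastic oracle call is the computation of one gradient $\nabla f_{ij}$ at one point.
   Formalization: The expected communication cost equals d+K(pd+(1-p)ζ_Q) only when each uncompressed vector is charged d and each quantized one ζ_Q; for the non-zero components actually sent it is an upper bound (equality fails, e.g. if all f_ij = 0). *)

theory Defs
  imports "HOL-Probability.Probability"
begin

definition gradient :: "(real^'d \<Rightarrow> real) \<Rightarrow> real^'d \<Rightarrow> real^'d" where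
  "gradient f x = (THE D. GDERIV f x :> D)"

definition local_obj :: "(nat \<Rightarrow> nat \<Rightarrow> real^'d \<Rightarrow> real) \<Rightarrow> nat \<Rightarrow> nat \<Rightarrow> real^'d \<Rightarrow> real" where
  "local_obj F m i x = (1 / real m) * (\<Sum>j=1..m. F i j x)"

definition global_obj :: "(nat \<Rightarrow> nat \<Rightarrow> real^'d \<Rightarrow> real) \<Rightarrow> nat \<Rightarrow> nat \<Rightarrow> real^'d \<Rightarrow> real" where
  "global_obj F n m x = (1 / real n) * (\<Sum>i=1..n. local_obj F m i x)"

definition smooth_with :: "real \<Rightarrow> (real^'d \<Rightarrow> real) \<Rightarrow> bool" where
  "smooth_with L f \<longleftrightarrow> (\<forall>x. f differentiable (at x)) \<and>
     (\<forall>x y. norm (gradient f x - gradient f y) \<le> L * norm (x - y))"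

definition polyak_lojasiewicz :: "real \<Rightarrow> (real^'d \<Rightarrow> real) \<Rightarrow> real^'d \<Rightarrow> bool" where
  "polyak_lojasiewicz \<mu> f xs \<longleftrightarrow> \<mu> > 0 \<and> (\<forall>x. (norm (gradient f x))\<^sup>2 \<ge> 2 * \<mu> * (f x - f xs))"

definition root_mean_square :: "nat \<Rightarrow> (nat \<Rightarrow> real) \<Rightarrow> real" where
  "root_mean_square n a = sqrt ((1 / real n) * (\<Sum>i=1..n. (a i)\<^sup>2))"

definition nnz :: "real^'d \<Rightarrow> nat" where
  "nnz y = card {r. y $ r \<noteq> 0}"

text \<open>
  A stochastic mapping is a jointly measurable map \<open>Q seed x\<close>, where the seed is drawn from a
  probability space \<open>S\<close>; independent evaluations of the mapping use independent seeds.
\<close>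

definition quantization :: "'s measure \<Rightarrow> ('s \<Rightarrow> real^'d \<Rightarrow> real^'d) \<Rightarrow> real \<Rightarrow> bool" where
  "quantization S Q \<omega> \<longleftrightarrow> prob_space S \<and> \<omega> > 0 \<and>
     (\<lambda>(\<sigma>, x). Q \<sigma> x) \<in> borel_measurable (S \<Otimes>\<^sub>M borel) \<and>
     (\<forall>x. integrable S (\<lambda>\<sigma>. Q \<sigma> x) \<and> (\<integral>\<sigma>. Q \<sigma> x \<partial>S) = x) \<and>
     (\<forall>x. integrable S (\<lambda>\<sigma>. (norm (Q \<sigma> x - x))\<^sup>2) \<and>
          (\<integral>\<sigma>. (norm (Q \<sigma> x - x))\<^sup>2 \<partial>S) \<le> \<omega> * (norm x)\<^sup>2)"

definition expected_density :: "'s measure \<Rightarrow> ('s \<Rightarrow> real^'d \<Rightarrow> real^'d) \<Rightarrow> real" where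
  "expected_density S Q = (SUP x. \<integral>\<sigma>. real (nnz (Q \<sigma> x)) \<partial>S)"

text \<open>
  Randomness of a run, on a common probability space: \<open>c k\<close> is the coin of iteration \<open>k\<close>,
  \<open>B k i\<close> the minibatch and \<open>s k i\<close> the quantization seed of worker \<open>i\<close> in iteration \<open>k\<close>.
  Minibatches are multisets, so that sampling without replacement (all multiplicities at most 1)
  and with replacement are both covered; their laws may depend on \<open>k\<close> and \<open>i\<close>.
\<close>

definition minibatch_diff ::
  "(nat \<Rightarrow> nat \<Rightarrow> real^'d \<Rightarrow> real) \<Rightarrow> nat \<Rightarrow> nat \<Rightarrow> nat multiset \<Rightarrow> real^'d \<Rightarrow> real^'d \<Rightarrow> real^'d" where
  "minibatch_diff F b i J x x' =
     (1 / real b) *\<^sub>R (\<Sum>j\<in>#J. gradient (F i j) x' - gradient (F i j) x)"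

text \<open>State after \<open>k\<close> iterations: the pair \<open>(x\<^sup>k, g\<^sup>k)\<close>. All workers share the coin \<open>c k\<close>.\<close>

primrec vr_marina ::
  "(nat \<Rightarrow> nat \<Rightarrow> real^'d \<Rightarrow> real) \<Rightarrow> nat \<Rightarrow> nat \<Rightarrow> ('s \<Rightarrow> real^'d \<Rightarrow> real^'d) \<Rightarrow> real^'d \<Rightarrow> real \<Rightarrow> nat \<Rightarrow>
   (nat \<Rightarrow> 'w \<Rightarrow> bool) \<Rightarrow> (nat \<Rightarrow> nat \<Rightarrow> 'w \<Rightarrow> nat multiset) \<Rightarrow> (nat \<Rightarrow> nat \<Rightarrow> 'w \<Rightarrow> 's) \<Rightarrow>
   nat \<Rightarrow> 'w \<Rightarrow> (real^'d) \<times> (real^'d)" where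
  "vr_marina F n m Q x0 \<gamma> b c B s 0 w = (x0, gradient (global_obj F n m) x0)"
| "vr_marina F n m Q x0 \<gamma> b c B s (Suc k) w =
     (let (x, g) = vr_marina F n m Q x0 \<gamma> b c B s k w;
          x' = x - \<gamma> *\<^sub>R g;
          g' = (\<lambda>i. if c k w then gradient (local_obj F m i) x'
                    else g + Q (s k i w) (minibatch_diff F b i (B k i w) x x'))
      in (x', (1 / real n) *\<^sub>R (\<Sum>i=1..n. g' i)))"

datatype source = Coin nat | Minibatch nat nat | Seed nat nat

definition source_events ::
  "'w measure \<Rightarrow> 's measure \<Rightarrow> (nat \<Rightarrow> 'w \<Rightarrow> bool) \<Rightarrow> (nat \<Rightarrow> nat \<Rightarrow> 'w \<Rightarrow> nat multiset) \<Rightarrow>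
   (nat \<Rightarrow> nat \<Rightarrow> 'w \<Rightarrow> 's) \<Rightarrow> source \<Rightarrow> 'w set set" where
  "source_events M S c B s z = (case z of
       Coin k \<Rightarrow> {c k -` A \<inter> space M | A. A \<in> sets (count_space UNIV)}
     | Minibatch k i \<Rightarrow> {B k i -` A \<inter> space M | A. A \<in> sets (count_space UNIV)}
     | Seed k i \<Rightarrow> {s k i -` A \<inter> space M | A. A \<in> sets S})"

text \<open>
  All coins, minibatches and seeds are drawn independently of each other; hence those of iteration
  \<open>k\<close> are independent of \<open>(x\<^sup>k, g\<^sup>k)\<close>.
\<close>

definition vr_marina_sampling ::
  "'w measure \<Rightarrow> 's measure \<Rightarrow> nat \<Rightarrow> nat \<Rightarrow> nat \<Rightarrow> real \<Rightarrow> (nat \<Rightarrow> 'w \<Rightarrow> bool) \<Rightarrow>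
   (nat \<Rightarrow> nat \<Rightarrow> 'w \<Rightarrow> nat multiset) \<Rightarrow> (nat \<Rightarrow> nat \<Rightarrow> 'w \<Rightarrow> 's) \<Rightarrow> bool" where
  "vr_marina_sampling M S n m b p c B s \<longleftrightarrow> prob_space M \<and>
     (\<forall>k. c k \<in> M \<rightarrow>\<^sub>M count_space UNIV \<and>
          distr M (count_space UNIV) (c k) = measure_pmf (bernoulli_pmf p)) \<and>
     (\<forall>k. \<forall>i\<in>{1..n}. B k i \<in> M \<rightarrow>\<^sub>M count_space UNIV \<and>
          (\<forall>w\<in>space M. set_mset (B k i w) \<subseteq> {1..m} \<and> size (B k i w) = b)) \<and>
     (\<forall>k. \<forall>i\<in>{1..n}. s k i \<in> M \<rightarrow>\<^sub>M S \<and> distr M S (s k i) = S) \<and>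
     prob_space.indep_sets M (source_events M S c B s)
       (range Coin \<union> {Minibatch k i | k i. i \<in> {1..n}} \<union> {Seed k i | k i. i \<in> {1..n}})"

text \<open>
  Average smoothness along a sequence of random points \<open>X\<close>, conditioning on the \<open>\<sigma>\<close>-algebra
  generated by two successive points. The library's conditional expectation is real-valued, so the
  vector identity is stated componentwise; the second moment uses the extended nonnegative version
  since \<open>real_cond_exp\<close> sends an infinite conditional expectation to 0.
\<close>

definition average_smooth ::
  "'w measure \<Rightarrow> (nat \<Rightarrow> nat \<Rightarrow> real^'d \<Rightarrow> real) \<Rightarrow> nat \<Rightarrow> nat \<Rightarrow> nat \<Rightarrow>
   (nat \<Rightarrow> nat \<Rightarrow> 'w \<Rightarrow> nat multiset) \<Rightarrow> (nat \<Rightarrow> 'w \<Rightarrow> real^'d) \<Rightarrow> (nat \<Rightarrow> real) \<Rightarrow> bool" where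
  "average_smooth M F n m b B X l \<longleftrightarrow> (\<forall>k. \<forall>i\<in>{1..n}.
     (let G = vimage_algebra (space M) (\<lambda>w. (X k w, X (Suc k) w)) borel;
          D = (\<lambda>w. gradient (local_obj F m i) (X (Suc k) w) - gradient (local_obj F m i) (X k w));
          D' = (\<lambda>w. minibatch_diff F b i (B k i w) (X k w) (X (Suc k) w))
      in l i \<ge> 0 \<and>
         (\<forall>r. AE w in M. real_cond_exp M G (\<lambda>w. D' w $ r) w = D w $ r) \<and>
         (AE w in M. nn_cond_exp M G (\<lambda>w. ennreal ((norm (D' w - D w))\<^sup>2)) w
            \<le> ennreal ((l i)\<^sup>2 / real b * (norm (X (Suc k) w - X k w))\<^sup>2))))"

text \<open>
  A query \<open>(j, y)\<close> is the computation of the gradient of \<open>F i j\<close> at \<open>y\<close>. The first summand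
  computes \<open>g\<^sup>0\<close>.
\<close>

definition oracle_queries ::
  "nat \<Rightarrow> (nat \<Rightarrow> 'w \<Rightarrow> bool) \<Rightarrow> (nat \<Rightarrow> nat \<Rightarrow> 'w \<Rightarrow> nat multiset) \<Rightarrow> (nat \<Rightarrow> 'w \<Rightarrow> real^'d) \<Rightarrow>
   nat \<Rightarrow> nat \<Rightarrow> 'w \<Rightarrow> (nat \<times> (real^'d)) multiset" where
  "oracle_queries m c B X i K w =
     {#(j, X 0 w). j \<in># mset_set {1..m}#} +
     (\<Sum>k<K. if c k w then {#(j, X (Suc k) w). j \<in># mset_set {1..m}#}
             else {#(j, X (Suc k) w). j \<in># B k i w#} + {#(j, X k w). j \<in># B k i w#})"

text \<open>
  Number of non-zero components actually transmitted to the server: a gradient of \<open>f\<^sub>i\<close> initially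
  and when the coin shows 1, a quantized vector otherwise.
\<close>

definition transmitted_nonzeros ::
  "(nat \<Rightarrow> nat \<Rightarrow> real^'d \<Rightarrow> real) \<Rightarrow> nat \<Rightarrow> ('s \<Rightarrow> real^'d \<Rightarrow> real^'d) \<Rightarrow> nat \<Rightarrow>
   (nat \<Rightarrow> 'w \<Rightarrow> bool) \<Rightarrow> (nat \<Rightarrow> nat \<Rightarrow> 'w \<Rightarrow> nat multiset) \<Rightarrow> (nat \<Rightarrow> nat \<Rightarrow> 'w \<Rightarrow> 's) \<Rightarrow>
   (nat \<Rightarrow> 'w \<Rightarrow> real^'d) \<Rightarrow> nat \<Rightarrow> nat \<Rightarrow> 'w \<Rightarrow> nat" where
  "transmitted_nonzeros F m Q b c B s X i K w =
     nnz (gradient (local_obj F m i) (X 0 w)) +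
     (\<Sum>k<K. nnz (if c k w then gradient (local_obj F m i) (X (Suc k) w)
                  else Q (s k i w) (minibatch_diff F b i (B k i w) (X k w) (X (Suc k) w))))"

text \<open>
  The same messages under nominal accounting: an uncompressed vector of length \<open>d\<close> is charged
  \<open>d\<close>, a quantized one is charged the expected density \<open>\<zeta>\<close>.
\<close>

definition charged_communication ::
  "nat \<Rightarrow> real \<Rightarrow> (nat \<Rightarrow> 'w \<Rightarrow> bool) \<Rightarrow> nat \<Rightarrow> 'w \<Rightarrow> real" where
  "charged_communication d \<zeta> c K w = real d + (\<Sum>k<K. if c k w then real d else \<zeta>)"

end

(* The estimator g is compared with the gradient of f along the run. Given (x, g), i.e. given
   (x^k, x^{k+1}), the deviations q_i - D_i of the workers' compressed messages are centred and
   uncorrelated: the seed of worker i is independent of everything else in the iteration, and so is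
   its minibatch, whose conditional moments are those of average smoothness. Hence the expected
   squared error E of g contracts by 1 - p up to a multiple of E|x^{k+1} - x^k|^2, and
   E(f(x) - f(xs)) + (gamma/p) E decreases by the factor 1 - gamma mu in every iteration. *)

theory Submission
  imports Defs
begin

section \<open>Gradients and smoothness\<close>

lemma gradient_eqI: "GDERIV f x :> D \<Longrightarrow> gradient f x = D"
  unfolding gradient_def
proof (rule the_equality)
  fix D' assume *: "GDERIV f x :> D" "GDERIV f x :> D'"
  then have "(\<lambda>h. h \<bullet> D) = (\<lambda>h. h \<bullet> D')"
    unfolding gderiv_def by (rule has_derivative_unique)
  then show "D' = D"
    by (metis vector_eq_rdot inner_commute)
qed

lemma GDERIV_gradient:
  fixes f :: "real^'d \<Rightarrow> real"
  assumes "f differentiable (at x)"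
  shows "GDERIV f x :> gradient f x"
proof -
  from assms obtain f' where f': "(f has_derivative f') (at x)"
    by (auto simp: differentiable_def)
  then interpret linear f' by (rule has_derivative_linear)
  have "f' h = h \<bullet> adjoint f' 1" for h
    using adjoint_works[OF linear_axioms, of h 1] by (simp add: inner_commute)
  then have "f' = (\<lambda>h. h \<bullet> adjoint f' 1)" by auto
  with f' have "GDERIV f x :> adjoint f' 1"
    unfolding gderiv_def by simp
  then show ?thesis using gradient_eqI by metis
qed

lemma gradient_scaled_sum:
  fixes h :: "'i \<Rightarrow> real^'d \<Rightarrow> real"
  assumes "\<And>i. i \<in> A \<Longrightarrow> h i differentiable (at x)"
  shows "gradient (\<lambda>y. a * (\<Sum>i\<in>A. h i y)) x = a *\<^sub>R (\<Sum>i\<in>A. gradient (h i) x)"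
proof (rule gradient_eqI)
  have "((\<lambda>y. a * (\<Sum>i\<in>A. h i y)) has_derivative (\<lambda>v. a * (\<Sum>i\<in>A. v \<bullet> gradient (h i) x))) (at x)"
    using GDERIV_gradient[OF assms]
    by (intro has_derivative_mult_right has_derivative_sum) (simp add: gderiv_def)
  then show "GDERIV (\<lambda>y. a * (\<Sum>i\<in>A. h i y)) x :> a *\<^sub>R (\<Sum>i\<in>A. gradient (h i) x)"
    by (simp add: gderiv_def inner_sum_right)
qed

lemma GDERIV_along_line:
  fixes f :: "real^'d \<Rightarrow> real"
  assumes "\<And>y. f differentiable (at y)"
  shows "((\<lambda>t. f (x + t *\<^sub>R v)) has_real_derivative gradient f (x + t *\<^sub>R v) \<bullet> v) (at t)"
proof -
  have "((\<lambda>t. x + t *\<^sub>R v) has_derivative (\<lambda>h. h *\<^sub>R v)) (at t)"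
    by (auto intro!: derivative_eq_intros)
  from diff_chain_at[OF this GDERIV_gradient[OF assms, unfolded gderiv_def]]
  show ?thesis
    by (simp add: has_field_derivative_def o_def inner_commute mult_commute_abs)
qed

lemma borel_measurable_gradient:
  fixes f :: "real^'d \<Rightarrow> real"
  assumes diff: "\<And>y. f differentiable (at y)"
  shows "gradient f \<in> borel_measurable borel"
proof (rule borel_measurable_euclidean_space[THEN iffD2], rule ballI)
  fix v :: "real^'d"
  have cont: "continuous_on UNIV f"
    using diff by (simp add: differentiable_imp_continuous_on differentiable_at_imp_differentiable_on)
  have [measurable]: "f \<in> borel_measurable borel"
    using cont by (rule borel_measurable_continuous_onI)
  have lim: "(\<lambda>k. (f (x + (1 / real (Suc k)) *\<^sub>R v) - f x) / (1 / real (Suc k)))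
      \<longlonglongrightarrow> gradient f x \<bullet> v" for x
  proof -
    have "((\<lambda>h. (f (x + h *\<^sub>R v) - f x) / h) \<longlongrightarrow> gradient f x \<bullet> v) (at 0)"
      using GDERIV_along_line[OF diff, of x v 0] by (simp add: DERIV_def)
    moreover have "filterlim (\<lambda>k. 1 / real (Suc k)) (at 0) sequentially"
      using LIMSEQ_inverse_real_of_nat
      by (intro filterlim_atI) (auto simp: inverse_eq_divide)
    ultimately show ?thesis
      by (rule filterlim_compose)
  qed
  show "(\<lambda>x. gradient f x \<bullet> v) \<in> borel_measurable borel"
    by (rule borel_measurable_LIMSEQ_real[OF lim]) measurable
qed

lemma smooth_with_descent:
  fixes f :: "real^'d \<Rightarrow> real"
  assumes "smooth_with L f"
  shows "f (x + v) \<le> f x + gradient f x \<bullet> v + L / 2 * (norm v)\<^sup>2"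
proof -
  from assms have diff: "\<And>y. f differentiable (at y)"
    and lip: "\<And>y z. norm (gradient f y - gradient f z) \<le> L * norm (y - z)"
    by (auto simp: smooth_with_def)
  define \<phi> where "\<phi> t = f (x + t *\<^sub>R v) - t * (gradient f x \<bullet> v) - L / 2 * t\<^sup>2 * (norm v)\<^sup>2" for t
  have "\<phi> 1 \<le> \<phi> 0"
  proof (rule DERIV_nonpos_imp_nonincreasing[of 0 1 \<phi>])
    fix t :: real assume "0 \<le> t" "t \<le> 1"
    have "(gradient f (x + t *\<^sub>R v) - gradient f x) \<bullet> v
        \<le> norm (gradient f (x + t *\<^sub>R v) - gradient f x) * norm v"
      by (rule norm_cauchy_schwarz)
    also have "\<dots> \<le> (L * norm (t *\<^sub>R v)) * norm v"
      using lip[of "x + t *\<^sub>R v" x] by (intro mult_right_mono) auto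
    also have "\<dots> = L * t * (norm v)\<^sup>2"
      using \<open>0 \<le> t\<close> by (simp add: power2_eq_square)
    finally have "gradient f (x + t *\<^sub>R v) \<bullet> v - gradient f x \<bullet> v - L * t * (norm v)\<^sup>2 \<le> 0"
      by (simp add: inner_diff_left)
    moreover have "(\<phi> has_real_derivative
        gradient f (x + t *\<^sub>R v) \<bullet> v - gradient f x \<bullet> v - L * t * (norm v)\<^sup>2) (at t)"
      unfolding \<phi>_def
      by (auto intro!: derivative_eq_intros GDERIV_along_line[OF diff])
    ultimately show "\<exists>y. (\<phi> has_real_derivative y) (at t) \<and> y \<le> 0" by blast
  qed simp
  then show ?thesis by (simp add: \<phi>_def)
qed

lemma smooth_with_descent_step:
  fixes f :: "real^'d \<Rightarrow> real"
  assumes "smooth_with L f" and "\<gamma> > 0"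
  shows "f (x - \<gamma> *\<^sub>R g) \<le> f x - \<gamma> / 2 * (norm (gradient f x))\<^sup>2
    - (1 / (2 * \<gamma>) - L / 2) * (norm (\<gamma> *\<^sub>R g))\<^sup>2 + \<gamma> / 2 * (norm (g - gradient f x))\<^sup>2"
proof -
  have "f (x - \<gamma> *\<^sub>R g) \<le> f x - \<gamma> * (gradient f x \<bullet> g) + L / 2 * (norm (\<gamma> *\<^sub>R g))\<^sup>2"
    using smooth_with_descent[OF assms(1), of x "- \<gamma> *\<^sub>R g"] by simp
  moreover have "\<gamma> / 2 * (norm (g - gradient f x))\<^sup>2
      = \<gamma> / 2 * (norm g)\<^sup>2 - \<gamma> * (gradient f x \<bullet> g) + \<gamma> / 2 * (norm (gradient f x))\<^sup>2"
    unfolding power2_norm_eq_inner by (simp add: inner_diff_left inner_diff_right inner_commute field_simps)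
  moreover have "(1 / (2 * \<gamma>) - L / 2) * (norm (\<gamma> *\<^sub>R g))\<^sup>2
      = \<gamma> / 2 * (norm g)\<^sup>2 - L / 2 * (norm (\<gamma> *\<^sub>R g))\<^sup>2"
    using \<open>\<gamma> > 0\<close> by (simp add: power2_eq_square field_simps)
  ultimately show ?thesis by linarith
qed

lemma borel_measurable_Lipschitz:
  fixes h :: "'a::euclidean_space \<Rightarrow> 'b::euclidean_space"
  assumes "\<And>x y. norm (h x - h y) \<le> L * norm (x - y)"
  shows "h \<in> borel_measurable borel"
proof -
  have "(max L 0)-lipschitz_on UNIV h"
    by (rule lipschitz_onI) (auto simp: dist_norm intro!: order_trans[OF assms] mult_right_mono)
  then show ?thesis
    by (intro borel_measurable_continuous_onI lipschitz_on_continuous_on)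
qed

lemma smooth_with_norm_gradient_le:
  assumes "smooth_with L f"
  shows "norm (gradient f x) \<le> norm (gradient f 0) + L * norm x"
  using assms norm_triangle_sub[of "gradient f x" "gradient f 0"]
  by (simp add: smooth_with_def) (metis add_left_mono diff_zero order_trans)

lemma arith_mean_le_root_mean_square:
  assumes "n \<ge> 1" shows "(1 / real n) * (\<Sum>i=1..n. a i) \<le> root_mean_square n a"
  unfolding root_mean_square_def
proof (rule real_le_rsqrt)
  have "(\<Sum>i=1..n. a i * 1)\<^sup>2 \<le> (\<Sum>i=1..n. (a i)\<^sup>2) * (\<Sum>i=1..n. 1\<^sup>2)"
    by (rule Cauchy_Schwarz_ineq_sum)
  then have "(\<Sum>i=1..n. a i)\<^sup>2 \<le> (\<Sum>i=1..n. (a i)\<^sup>2) * real n" by simp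
  then show "((1 / real n) * (\<Sum>i=1..n. a i))\<^sup>2 \<le> 1 / real n * (\<Sum>i=1..n. (a i)\<^sup>2)"
    using assms by (simp add: power_mult_distrib power_divide divide_simps power2_eq_square)
qed

lemma smooth_with_mean:
  fixes h :: "nat \<Rightarrow> real^'d \<Rightarrow> real"
  assumes "n \<ge> 1" and smooth: "\<And>i. i \<in> {1..n} \<Longrightarrow> smooth_with (a i) (h i)"
  shows "smooth_with (root_mean_square n a) (\<lambda>x. (1 / real n) * (\<Sum>i=1..n. h i x))"
  unfolding smooth_with_def
proof (intro conjI allI)
  have diff: "i \<in> {1..n} \<Longrightarrow> h i differentiable (at x)" for i x
    using smooth by (auto simp: smooth_with_def)
  show "(\<lambda>x. (1 / real n) * (\<Sum>i=1..n. h i x)) differentiable (at x)" for x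
    using diff by (intro differentiable_mult differentiable_const differentiable_sum) auto
  have gradient: "gradient (\<lambda>x. (1 / real n) * (\<Sum>i=1..n. h i x)) x
      = (1 / real n) *\<^sub>R (\<Sum>i=1..n. gradient (h i) x)" for x
    using diff by (rule gradient_scaled_sum)
  fix x y :: "real^'d"
  have "norm (\<Sum>i=1..n. gradient (h i) x - gradient (h i) y) \<le> (\<Sum>i=1..n. a i * norm (x - y))"
    using smooth by (intro order_trans[OF norm_sum] sum_mono) (auto simp: smooth_with_def)
  then have "(1 / real n) * norm (\<Sum>i=1..n. gradient (h i) x - gradient (h i) y)
      \<le> ((1 / real n) * (\<Sum>i=1..n. a i)) * norm (x - y)"
    by (simp add: sum_distrib_right divide_right_mono)
  also have "\<dots> \<le> root_mean_square n a * norm (x - y)"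
    using arith_mean_le_root_mean_square[OF \<open>n \<ge> 1\<close>] by (rule mult_right_mono) simp
  finally show "norm (gradient (\<lambda>x. (1 / real n) * (\<Sum>i=1..n. h i x)) x
      - gradient (\<lambda>x. (1 / real n) * (\<Sum>i=1..n. h i x)) y) \<le> root_mean_square n a * norm (x - y)"
    unfolding gradient by (simp add: sum_subtractf flip: scaleR_diff_right)
qed

section \<open>Square-integrable random vectors\<close>

definition square_integrable :: "'a measure \<Rightarrow> ('a \<Rightarrow> 'b::euclidean_space) \<Rightarrow> bool" where
  "square_integrable M v \<longleftrightarrow> v \<in> borel_measurable M \<and> integrable M (\<lambda>w. (norm (v w))\<^sup>2)"

lemma norm_add_squared_le:
  fixes a b :: "'a::real_inner"
  shows "(norm (a + b))\<^sup>2 \<le> 2 * (norm a)\<^sup>2 + 2 * (norm b)\<^sup>2"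
proof -
  have "(norm (a + b))\<^sup>2 + (norm (a - b))\<^sup>2 = 2 * (norm a)\<^sup>2 + 2 * (norm b)\<^sup>2"
    by (simp add: power2_norm_eq_inner inner_simps)
  then show ?thesis by (smt (verit) zero_le_power2)
qed

lemma square_integrable_add:
  assumes "square_integrable M u" "square_integrable M v"
  shows "square_integrable M (\<lambda>w. u w + v w)"
  unfolding square_integrable_def
proof
  have [measurable]: "u \<in> borel_measurable M" "v \<in> borel_measurable M"
    using assms by (auto simp: square_integrable_def)
  show "(\<lambda>w. u w + v w) \<in> borel_measurable M" by measurable
  show "integrable M (\<lambda>w. (norm (u w + v w))\<^sup>2)"
    by (rule Bochner_Integration.integrable_bound[of _ "\<lambda>w. 2 * (norm (u w))\<^sup>2 + 2 * (norm (v w))\<^sup>2"])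
       (use assms in \<open>auto simp: square_integrable_def norm_add_squared_le\<close>)
qed

lemma square_integrable_scaleR:
  assumes "square_integrable M u" shows "square_integrable M (\<lambda>w. a *\<^sub>R u w)"
  using assms by (auto simp: square_integrable_def power_mult_distrib)

lemma square_integrable_diff:
  assumes "square_integrable M u" "square_integrable M v"
  shows "square_integrable M (\<lambda>w. u w - v w)"
  using square_integrable_add[OF assms(1) square_integrable_scaleR[OF assms(2), of "- 1"]] by simp

lemma square_integrable_sum:
  assumes "\<And>i. i \<in> A \<Longrightarrow> square_integrable M (u i)"
  shows "square_integrable M (\<lambda>w. \<Sum>i\<in>A. u i w)"
  using assms
proof (induction A rule: infinite_finite_induct)
  case (insert i A)
  then show ?case by (simp add: square_integrable_add)
qed (auto simp: square_integrable_def)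

lemma square_integrable_inner:
  assumes "square_integrable M u" "square_integrable M v"
  shows "integrable M (\<lambda>w. u w \<bullet> v w)"
proof -
  have "u w \<bullet> v w = ((norm (u w + v w))\<^sup>2 - (norm (u w))\<^sup>2 - (norm (v w))\<^sup>2) / 2" for w
    by (simp add: power2_norm_eq_inner inner_simps inner_commute)
  moreover have "integrable M (\<lambda>w. ((norm (u w + v w))\<^sup>2 - (norm (u w))\<^sup>2 - (norm (v w))\<^sup>2) / 2)"
    using assms square_integrable_add[OF assms] by (simp add: square_integrable_def)
  ultimately show ?thesis by (simp only:)
qed

lemma square_integrable_affine_bound:
  assumes "finite_measure M" "square_integrable M u" "v \<in> borel_measurable M"
    and "\<And>w. norm (v w) \<le> a + r * norm (u w)"
  shows "square_integrable M v"
proof -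
  interpret finite_measure M by fact
  have [measurable]: "u \<in> borel_measurable M" and "integrable M (\<lambda>w. (norm (u w))\<^sup>2)"
    using assms(2) by (auto simp: square_integrable_def)
  moreover have "(norm (v w))\<^sup>2 \<le> 2 * a\<^sup>2 + 2 * (r\<^sup>2 * (norm (u w))\<^sup>2)" for w
  proof -
    have "(norm (v w))\<^sup>2 \<le> (a + r * norm (u w))\<^sup>2"
      using assms(4) by (rule power_mono) simp
    also have "\<dots> \<le> 2 * a\<^sup>2 + 2 * (r * norm (u w))\<^sup>2"
      using norm_add_squared_le[of a "r * norm (u w)"] by simp
    finally show ?thesis by (simp add: power_mult_distrib)
  qed
  ultimately show ?thesis
    unfolding square_integrable_def using assms(3)
    by (auto intro!: Bochner_Integration.integrable_bound[of _ "\<lambda>w. 2 * a\<^sup>2 + 2 * (r\<^sup>2 * (norm (u w))\<^sup>2)" "\<lambda>w. (norm (v w))\<^sup>2"])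
qed

lemma integral_norm_add_squared_orthogonal:
  assumes "square_integrable M u" "square_integrable M v" "(\<integral>w. u w \<bullet> v w \<partial>M) = 0"
  shows "(\<integral>w. (norm (u w + v w))\<^sup>2 \<partial>M) = (\<integral>w. (norm (u w))\<^sup>2 \<partial>M) + (\<integral>w. (norm (v w))\<^sup>2 \<partial>M)"
proof -
  have "(norm (u w + v w))\<^sup>2 = (norm (u w))\<^sup>2 + (norm (v w))\<^sup>2 + 2 * (u w \<bullet> v w)" for w
    by (simp add: power2_norm_eq_inner inner_simps inner_commute)
  then show ?thesis
    using assms square_integrable_inner[OF assms(1,2)] by (simp add: square_integrable_def)
qed

lemma integral_norm_sum_squared_orthogonal:
  assumes "finite A" "\<And>i. i \<in> A \<Longrightarrow> square_integrable M (u i)"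
    and "\<And>i j. i \<in> A \<Longrightarrow> j \<in> A \<Longrightarrow> i \<noteq> j \<Longrightarrow> (\<integral>w. u i w \<bullet> u j w \<partial>M) = 0"
  shows "(\<integral>w. (norm (\<Sum>i\<in>A. u i w))\<^sup>2 \<partial>M) = (\<Sum>i\<in>A. \<integral>w. (norm (u i w))\<^sup>2 \<partial>M)"
  using assms
proof (induction A)
  case (insert i A)
  have "(\<integral>w. u i w \<bullet> (\<Sum>j\<in>A. u j w) \<partial>M) = (\<Sum>j\<in>A. \<integral>w. u i w \<bullet> u j w \<partial>M)"
    unfolding inner_sum_right using insert.prems
    by (intro Bochner_Integration.integral_sum square_integrable_inner) auto
  also have "\<dots> = 0"
    using insert by (intro sum.neutral) auto
  finally have "(\<integral>w. (norm (u i w + (\<Sum>j\<in>A. u j w)))\<^sup>2 \<partial>M)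
      = (\<integral>w. (norm (u i w))\<^sup>2 \<partial>M) + (\<integral>w. (norm (\<Sum>j\<in>A. u j w))\<^sup>2 \<partial>M)"
    using insert.prems by (intro integral_norm_add_squared_orthogonal square_integrable_sum) auto
  with insert show ?case by simp
qed simp

section \<open>Averaging over an independent random variable\<close>

context prob_space
begin

text \<open>The library's \<open>indep_var\<close> forces both variables to have the same range type.\<close>

definition indep_of :: "'a measure \<Rightarrow> 'b measure \<Rightarrow> ('a \<Rightarrow> 'b) \<Rightarrow> bool" where
  "indep_of H N Y \<longleftrightarrow> subalgebra M H \<and> Y \<in> M \<rightarrow>\<^sub>M N \<and>
     (\<forall>A\<in>sets H. \<forall>B\<in>sets N. prob (A \<inter> (Y -` B \<inter> space M)) = prob A * prob (Y -` B \<inter> space M))"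

lemma indep_ofD:
  assumes "indep_of H N Y"
  shows "(\<lambda>w. w) \<in> M \<rightarrow>\<^sub>M H" "Y \<in> M \<rightarrow>\<^sub>M N"
  using assms unfolding indep_of_def subalgebra_def
  by (auto intro!: measurableI dest: sets.sets_into_space)

lemma indep_of_distr_pair:
  assumes "indep_of H N Y"
  shows "distr M H (\<lambda>w. w) \<Otimes>\<^sub>M distr M N Y = distr M (H \<Otimes>\<^sub>M N) (\<lambda>w. (w, Y w))"
proof (rule pair_measure_eqI)
  note [measurable] = indep_ofD[OF assms]
  show "sigma_finite_measure (distr M H (\<lambda>w. w))" "sigma_finite_measure (distr M N Y)"
    by (auto intro!: prob_space_imp_sigma_finite prob_space_distr)
  show "sets (distr M H (\<lambda>w. w) \<Otimes>\<^sub>M distr M N Y) = sets (distr M (H \<Otimes>\<^sub>M N) (\<lambda>w. (w, Y w)))"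
    by (simp add: sets_pair_measure)
  fix A B assume "A \<in> sets (distr M H (\<lambda>w. w))" "B \<in> sets (distr M N Y)"
  then have [measurable]: "A \<in> sets H" "B \<in> sets N" by auto
  have "A \<in> sets M" using assms \<open>A \<in> sets H\<close> by (auto simp: indep_of_def subalgebra_def)
  then have "(\<lambda>w. w) -` A \<inter> space M = A"
    "(\<lambda>w. (w, Y w)) -` (A \<times> B) \<inter> space M = A \<inter> (Y -` B \<inter> space M)"
    using sets.sets_into_space by auto
  then show "emeasure (distr M H (\<lambda>w. w)) A * emeasure (distr M N Y) B
      = emeasure (distr M (H \<Otimes>\<^sub>M N) (\<lambda>w. (w, Y w))) (A \<times> B)"
    using assms by (simp add: emeasure_distr emeasure_eq_measure indep_of_def ennreal_mult)
qed

lemma indep_of_nn_integral: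
  assumes indep: "indep_of H N Y"
    and h[measurable]: "(\<lambda>(w, y). h w y) \<in> borel_measurable (H \<Otimes>\<^sub>M N)"
  shows "(\<integral>\<^sup>+w. h w (Y w) \<partial>M) = (\<integral>\<^sup>+w. (\<integral>\<^sup>+y. h w y \<partial>distr M N Y) \<partial>M)"
proof -
  note id[measurable] = indep_ofD(1)[OF indep] and Y[measurable] = indep_ofD(2)[OF indep]
  interpret Y: prob_space "distr M N Y" by (rule prob_space_distr) fact
  have "(\<integral>\<^sup>+w. h w (Y w) \<partial>M) = (\<integral>\<^sup>+z. (case z of (w, y) \<Rightarrow> h w y) \<partial>distr M (H \<Otimes>\<^sub>M N) (\<lambda>w. (w, Y w)))"
    by (subst nn_integral_distr) auto
  also have "\<dots> = (\<integral>\<^sup>+z. (case z of (w, y) \<Rightarrow> h w y) \<partial>(distr M H (\<lambda>w. w) \<Otimes>\<^sub>M distr M N Y))"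
    using indep by (simp add: indep_of_distr_pair)
  also have "\<dots> = (\<integral>\<^sup>+w. (\<integral>\<^sup>+y. h w y \<partial>distr M N Y) \<partial>distr M H (\<lambda>w. w))"
    by (subst Y.nn_integral_fst[symmetric]) (auto simp: measurable_distr_eq1)
  also have "\<dots> = (\<integral>\<^sup>+w. (\<integral>\<^sup>+y. h w y \<partial>distr M N Y) \<partial>M)"
    by (subst nn_integral_distr) measurable
  finally show ?thesis .
qed

lemma indep_of_integral:
  fixes h :: "'a \<Rightarrow> 'b \<Rightarrow> real"
  assumes indep: "indep_of H N Y"
    and h[measurable]: "(\<lambda>(w, y). h w y) \<in> borel_measurable (H \<Otimes>\<^sub>M N)"
    and int: "integrable M (\<lambda>w. h w (Y w))"
  shows "(\<integral>w. h w (Y w) \<partial>M) = (\<integral>w. (\<integral>y. h w y \<partial>distr M N Y) \<partial>M)"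
proof -
  note id[measurable] = indep_ofD(1)[OF indep] and Y[measurable] = indep_ofD(2)[OF indep]
  interpret H: prob_space "distr M H (\<lambda>w. w)" by (rule prob_space_distr) fact
  interpret Y: prob_space "distr M N Y" by (rule prob_space_distr) fact
  interpret HY: pair_sigma_finite "distr M H (\<lambda>w. w)" "distr M N Y" ..
  have eq: "distr M (H \<Otimes>\<^sub>M N) (\<lambda>w. (w, Y w)) = distr M H (\<lambda>w. w) \<Otimes>\<^sub>M distr M N Y"
    using indep by (simp add: indep_of_distr_pair)
  have int': "integrable (distr M H (\<lambda>w. w) \<Otimes>\<^sub>M distr M N Y) (\<lambda>(w, y). h w y)"
    unfolding eq[symmetric] using int by (subst integrable_distr_eq) auto
  have "(\<integral>w. h w (Y w) \<partial>M) = (\<integral>z. (case z of (w, y) \<Rightarrow> h w y) \<partial>distr M (H \<Otimes>\<^sub>M N) (\<lambda>w. (w, Y w)))"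
    by (subst integral_distr) auto
  also have "\<dots> = (\<integral>w. (\<integral>y. h w y \<partial>distr M N Y) \<partial>distr M H (\<lambda>w. w))"
    unfolding eq using HY.integral_fst'[OF int'] by simp
  also have "\<dots> = (\<integral>w. (\<integral>y. h w y \<partial>distr M N Y) \<partial>M)"
    by (subst integral_distr) measurable
  finally show ?thesis .
qed

lemma kernel_variance:
  fixes h :: "'a \<Rightarrow> 'c \<Rightarrow> 'b::euclidean_space"
  assumes indep: "indep_of H N Y"
    and h[measurable]: "(\<lambda>(w, y). h w y) \<in> borel_measurable (H \<Otimes>\<^sub>M N)"
    and m[measurable]: "m \<in> borel_measurable H"
    and var: "AE w in M. (\<integral>\<^sup>+y. ennreal ((norm (h w y - m w))\<^sup>2) \<partial>distr M N Y) \<le> ennreal (v w)"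
    and v: "integrable M v" "\<And>w. v w \<ge> 0"
  shows "square_integrable M (\<lambda>w. h w (Y w) - m w)"
    and "(\<integral>w. (norm (h w (Y w) - m w))\<^sup>2 \<partial>M) \<le> (\<integral>w. v w \<partial>M)"
proof -
  note id[measurable] = indep_ofD(1)[OF indep] and Y[measurable] = indep_ofD(2)[OF indep]
  have hM[measurable]: "(\<lambda>w. h w (Y w)) \<in> borel_measurable M"
    using measurable_compose[OF measurable_Pair[OF id Y] h] by simp
  have mM[measurable]: "m \<in> borel_measurable M"
    using measurable_compose[OF id m] by simp
  have "(\<integral>\<^sup>+w. ennreal ((norm (h w (Y w) - m w))\<^sup>2) \<partial>M)
      = (\<integral>\<^sup>+w. (\<integral>\<^sup>+y. ennreal ((norm (h w y - m w))\<^sup>2) \<partial>distr M N Y) \<partial>M)"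
    by (rule indep_of_nn_integral[OF indep]) measurable
  also have "\<dots> \<le> (\<integral>\<^sup>+w. ennreal (v w) \<partial>M)"
    using var by (rule nn_integral_mono_AE)
  also have "\<dots> = ennreal (\<integral>w. v w \<partial>M)"
    using v by (intro nn_integral_eq_integral) auto
  finally have le: "(\<integral>\<^sup>+w. ennreal ((norm (h w (Y w) - m w))\<^sup>2) \<partial>M) \<le> ennreal (\<integral>w. v w \<partial>M)" .
  then have int: "integrable M (\<lambda>w. (norm (h w (Y w) - m w))\<^sup>2)"
    by (intro integrableI_bounded) (auto intro: order.strict_trans1)
  then show "square_integrable M (\<lambda>w. h w (Y w) - m w)"
    by (auto simp: square_integrable_def)
  from le int v show "(\<integral>w. (norm (h w (Y w) - m w))\<^sup>2 \<partial>M) \<le> (\<integral>w. v w \<partial>M)"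
    by (subst (asm) nn_integral_eq_integral) (auto simp: ennreal_le_iff)
qed

lemma kernel_unbiased:
  fixes h :: "'a \<Rightarrow> 'c \<Rightarrow> 'b::euclidean_space"
  assumes indep: "indep_of H N Y"
    and h[measurable]: "(\<lambda>(w, y). h w y) \<in> borel_measurable (H \<Otimes>\<^sub>M N)"
    and u[measurable]: "u \<in> borel_measurable H"
    and sq: "square_integrable M u" "square_integrable M (\<lambda>w. h w (Y w))" "square_integrable M m"
    and mean: "AE w in M. integrable (distr M N Y) (h w) \<and> (\<integral>y. h w y \<partial>distr M N Y) = m w"
  shows "(\<integral>w. u w \<bullet> (h w (Y w) - m w) \<partial>M) = 0"
proof -
  note id[measurable] = indep_ofD(1)[OF indep] and Y[measurable] = indep_ofD(2)[OF indep]
  interpret Y: prob_space "distr M N Y" by (rule prob_space_distr) fact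
  have "(\<integral>w. u w \<bullet> h w (Y w) \<partial>M) = (\<integral>w. (\<integral>y. u w \<bullet> h w y \<partial>distr M N Y) \<partial>M)"
    by (rule indep_of_integral[OF indep])
       (use sq square_integrable_inner in \<open>auto\<close>)
  also have "\<dots> = (\<integral>w. u w \<bullet> m w \<partial>M)"
  proof (rule integral_cong_AE)
    have "(\<lambda>w. \<integral>y. u w \<bullet> h w y \<partial>distr M N Y) \<in> borel_measurable H" by measurable
    from measurable_compose[OF id this]
    show "(\<lambda>w. \<integral>y. u w \<bullet> h w y \<partial>distr M N Y) \<in> borel_measurable M" .
    show "(\<lambda>w. u w \<bullet> m w) \<in> borel_measurable M"
      using sq square_integrable_inner by blast
    show "AE w in M. (\<integral>y. u w \<bullet> h w y \<partial>distr M N Y) = u w \<bullet> m w"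
      using mean by eventually_elim auto
  qed
  finally show ?thesis
    using square_integrable_inner[OF sq(1,2)] square_integrable_inner[OF sq(1,3)]
    by (simp add: inner_diff_right)
qed

lemma nn_cond_exp_indep_kernel:
  assumes sub: "subalgebra M G"
    and indep: "indep_of G N Y"
    and h[measurable]: "(\<lambda>(w, y). h w y) \<in> borel_measurable (G \<Otimes>\<^sub>M N)"
    and eq: "\<And>w. w \<in> space M \<Longrightarrow> r w = h w (Y w)"
  shows "AE w in M. (\<integral>\<^sup>+y. h w y \<partial>distr M N Y) = nn_cond_exp M G r w"
proof -
  interpret finite_measure_subalgebra M G by unfold_locales fact
  note id[measurable] = indep_ofD(1)[OF indep] and Y[measurable] = indep_ofD(2)[OF indep]
  interpret Y: prob_space "distr M N Y" by (rule prob_space_distr) fact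
  show ?thesis
  proof (rule nn_cond_exp_charact)
    have "(\<lambda>w. h w (Y w)) \<in> borel_measurable M"
      using measurable_compose[OF measurable_Pair[OF id Y] h] by simp
    then show "r \<in> borel_measurable M"
      using eq by (simp cong: measurable_cong)
    show "(\<lambda>w. \<integral>\<^sup>+y. h w y \<partial>distr M N Y) \<in> borel_measurable G" by measurable
    fix A assume [measurable]: "A \<in> sets G"
    have "(\<integral>\<^sup>+w\<in>A. r w \<partial>M) = (\<integral>\<^sup>+w. h w (Y w) * indicator A w \<partial>M)"
      using eq by (auto intro!: nn_integral_cong)
    also have "\<dots> = (\<integral>\<^sup>+w. (\<integral>\<^sup>+y. h w y * indicator A w \<partial>distr M N Y) \<partial>M)"
      by (rule indep_of_nn_integral[OF indep]) measurable
    also have "\<dots> = (\<integral>\<^sup>+w\<in>A. (\<integral>\<^sup>+y. h w y \<partial>distr M N Y) \<partial>M)"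
    proof (rule nn_integral_cong)
      fix w assume "w \<in> space M"
      then have "w \<in> space G" using sub by (simp add: subalgebra_def)
      then have "h w \<in> borel_measurable (distr M N Y)"
        using measurable_Pair2[OF h] by simp
      then show "(\<integral>\<^sup>+y. h w y * indicator A w \<partial>distr M N Y) = (\<integral>\<^sup>+y. h w y \<partial>distr M N Y) * indicator A w"
        by (rule nn_integral_multc)
    qed
    finally show "(\<integral>\<^sup>+w\<in>A. r w \<partial>M) = (\<integral>\<^sup>+w\<in>A. (\<integral>\<^sup>+y. h w y \<partial>distr M N Y) \<partial>M)" .
  qed
qed

lemma real_cond_exp_indep_kernel:
  fixes h :: "'a \<Rightarrow> 'c \<Rightarrow> real"
  assumes sub: "subalgebra M G"
    and indep: "indep_of G N Y"
    and h[measurable]: "(\<lambda>(w, y). h w y) \<in> borel_measurable (G \<Otimes>\<^sub>M N)"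
    and int: "\<And>w. w \<in> space M \<Longrightarrow> integrable (distr M N Y) (h w)"
    and eq: "\<And>w. w \<in> space M \<Longrightarrow> r w = h w (Y w)"
  shows "AE w in M. (\<integral>y. h w y \<partial>distr M N Y) = real_cond_exp M G r w"
proof -
  have "AE w in M. (\<integral>\<^sup>+y. ennreal (h w y) \<partial>distr M N Y) = nn_cond_exp M G (\<lambda>w. ennreal (r w)) w"
    using eq by (intro nn_cond_exp_indep_kernel[OF sub indep]) simp_all
  moreover have "AE w in M. (\<integral>\<^sup>+y. ennreal (- h w y) \<partial>distr M N Y) = nn_cond_exp M G (\<lambda>w. ennreal (- r w)) w"
    using eq by (intro nn_cond_exp_indep_kernel[OF sub indep]) simp_all
  ultimately show ?thesis
    using AE_space by eventually_elim (simp add: real_cond_exp_def real_lebesgue_integral_def int)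
qed

lemma indep_of_subalgebra:
  assumes "indep_of H N Y" "subalgebra H G"
  shows "indep_of G N Y"
  using assms by (auto simp: indep_of_def subalgebra_def)

end

section \<open>The run of VR-MARINA\<close>

lemma countable_multisets: "countable (UNIV :: 'a::countable multiset set)"
proof -
  have "UNIV = range (mset :: 'a list \<Rightarrow> 'a multiset)"
    using ex_mset by (metis surj_def)
  then show ?thesis by (metis countable_image countableI_type)
qed

lemma measurable_pair_multiset:
  fixes h :: "'a \<Rightarrow> 'i::countable multiset \<Rightarrow> 'b"
  assumes "\<And>J. (\<lambda>w. h w J) \<in> N \<rightarrow>\<^sub>M K"
  shows "(\<lambda>(w, J). h w J) \<in> N \<Otimes>\<^sub>M count_space UNIV \<rightarrow>\<^sub>M K"
proof -
  have "(\<lambda>(J, w). h w J) \<in> count_space UNIV \<Otimes>\<^sub>M N \<rightarrow>\<^sub>M K"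
    using assms by (intro measurable_pair_measure_countable1 countable_multisets) simp
  then show ?thesis
    by (subst measurable_pair_swap_iff) (simp add: case_prod_unfold)
qed

lemma borel_measurable_minibatch_diff:
  assumes "\<And>j. j \<in># J \<Longrightarrow> gradient (F i j) \<in> borel_measurable borel"
    and [measurable]: "x \<in> borel_measurable N" "x' \<in> borel_measurable N"
  shows "(\<lambda>w. minibatch_diff F b i J (x w) (x' w)) \<in> borel_measurable N"
proof -
  have "(\<lambda>w. \<Sum>j\<in>#J. gradient (F i j) (x' w) - gradient (F i j) (x w)) \<in> borel_measurable N"
    using assms(1)
  proof (induction J)
    case (add j J)
    then have [measurable]: "gradient (F i j) \<in> borel_measurable borel"
      "(\<lambda>w. \<Sum>j\<in>#J. gradient (F i j) (x' w) - gradient (F i j) (x w)) \<in> borel_measurable N" by auto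
    show ?case by simp
  qed simp
  then show ?thesis unfolding minibatch_diff_def by measurable
qed

lemma Int_stable_preimages: "Int_stable {f -` A \<inter> \<Omega> | A. A \<in> sets N}"
proof (rule Int_stableI, clarify)
  fix A B assume "A \<in> sets N" "B \<in> sets N"
  then show "\<exists>C. f -` A \<inter> \<Omega> \<inter> (f -` B \<inter> \<Omega>) = f -` C \<inter> \<Omega> \<and> C \<in> sets N"
    by (intro exI[of _ "A \<inter> B"]) auto
qed

lemma Int_stable_source_events: "Int_stable (source_events M S c B s z)"
  unfolding source_events_def by (cases z) (simp_all only: source.case Int_stable_preimages)

locale vr_marina_run =
  fixes F :: "nat \<Rightarrow> nat \<Rightarrow> real^'d \<Rightarrow> real" and n m b :: nat and x0 :: "real^'d" and \<gamma> p \<omega> :: real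
    and Ls ls :: "nat \<Rightarrow> real" and S :: "'s measure" and Q :: "'s \<Rightarrow> real^'d \<Rightarrow> real^'d"
    and M :: "'w measure" and c :: "nat \<Rightarrow> 'w \<Rightarrow> bool" and B :: "nat \<Rightarrow> nat \<Rightarrow> 'w \<Rightarrow> nat multiset"
    and s :: "nat \<Rightarrow> nat \<Rightarrow> 'w \<Rightarrow> 's"
  assumes n_pos: "n \<ge> 1" and b_pos: "b \<ge> 1"
    and F_differentiable: "\<And>i j y. i \<in> {1..n} \<Longrightarrow> j \<in> {1..m} \<Longrightarrow> F i j differentiable (at y)"
    and smooth: "\<And>i. i \<in> {1..n} \<Longrightarrow> smooth_with (Ls i) (local_obj F m i)"
    and quantization: "quantization S Q \<omega>"
    and p_pos: "0 < p" and p_le: "p \<le> 1"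
    and sampling: "vr_marina_sampling M S n m b p c B s"
    and average_smooth: "average_smooth M F n m b B (\<lambda>k w. fst (vr_marina F n m Q x0 \<gamma> b c B s k w)) ls"
begin

sublocale prob_space M
  using sampling by (simp add: vr_marina_sampling_def)

sublocale S: prob_space S
  using quantization by (simp add: quantization_def)

definition X :: "nat \<Rightarrow> 'w \<Rightarrow> real^'d" where
  "X k w = fst (vr_marina F n m Q x0 \<gamma> b c B s k w)"

lemma average_smooth_X: "average_smooth M F n m b B X ls"
  using average_smooth unfolding X_def[abs_def] .

definition G :: "nat \<Rightarrow> 'w \<Rightarrow> real^'d" where
  "G k w = snd (vr_marina F n m Q x0 \<gamma> b c B s k w)"

definition D :: "nat \<Rightarrow> nat \<Rightarrow> 'w \<Rightarrow> real^'d" where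
  "D k i w = gradient (local_obj F m i) (X (Suc k) w) - gradient (local_obj F m i) (X k w)"

definition D' :: "nat \<Rightarrow> nat \<Rightarrow> 'w \<Rightarrow> real^'d" where
  "D' k i w = minibatch_diff F b i (B k i w) (X k w) (X (Suc k) w)"

definition q :: "nat \<Rightarrow> nat \<Rightarrow> 'w \<Rightarrow> real^'d" where
  "q k i w = Q (s k i w) (D' k i w)"

lemma X_0: "X 0 w = x0" and G_0: "G 0 w = gradient (global_obj F n m) x0"
  by (simp_all add: X_def G_def)

lemma X_Suc: "X (Suc k) w = X k w - \<gamma> *\<^sub>R G k w"
  by (simp add: X_def G_def Let_def case_prod_unfold)

lemma G_Suc: "G (Suc k) w = (1 / real n) *\<^sub>R
  (\<Sum>i=1..n. if c k w then gradient (local_obj F m i) (X (Suc k) w) else G k w + q k i w)"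
  unfolding q_def D'_def X_Suc unfolding X_def G_def by (simp add: Let_def case_prod_unfold)

definition sources :: "source set" where
  "sources = range Coin \<union> {Minibatch k i | k i. i \<in> {1..n}} \<union> {Seed k i | k i. i \<in> {1..n}}"

definition src :: "source set \<Rightarrow> 'w measure" where
  "src I = sigma (space M) (\<Union>z\<in>I. source_events M S c B s z)"

definition past :: "nat \<Rightarrow> source set" where
  "past k = Coin ` {..<k} \<union> {Minibatch l i | l i. l < k \<and> i \<in> {1..n}} \<union> {Seed l i | l i. l < k \<and> i \<in> {1..n}}"

text \<open>Everything drawn up to iteration \<open>k\<close> except the coin of that iteration.\<close>

definition stage :: "nat \<Rightarrow> source set" where
  "stage k = past k \<union> Minibatch k ` {1..n} \<union> Seed k ` {1..n}"

lemma past_mono: "k \<le> l \<Longrightarrow> past k \<subseteq> past l"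
  by (fastforce simp: past_def)

lemma stage_subset_sources: "stage k \<subseteq> sources"
  by (auto simp: stage_def past_def sources_def)

lemma past_subset_stage: "past k \<subseteq> stage k"
  by (auto simp: stage_def)

lemma past_sources: "past k \<subseteq> sources"
  using stage_subset_sources past_subset_stage by blast

lemma in_stage: "i \<in> {1..n} \<Longrightarrow> Minibatch k i \<in> stage k" "i \<in> {1..n} \<Longrightarrow> Seed k i \<in> stage k"
  by (auto simp: stage_def)

lemma current_notin_past:
  "Coin k \<notin> past k" "Minibatch k i \<notin> past k" "Seed k i \<notin> past k" "Coin k \<notin> stage k"
  by (auto simp: past_def stage_def)

lemma source_events_subset: "source_events M S c B s z \<subseteq> Pow (space M)"
  by (cases z) (auto simp: source_events_def)

lemma space_src: "space (src I) = space M"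
  unfolding src_def using source_events_subset by (intro space_measure_of) blast

lemma sets_src: "sets (src I) = sigma_sets (space M) (\<Union>z\<in>I. source_events M S c B s z)"
  unfolding src_def using source_events_subset by (intro sets_measure_of) blast

lemma indep_sources: "indep_sets (source_events M S c B s) sources"
  using sampling by (simp add: vr_marina_sampling_def sources_def)

lemma subalgebra_src: assumes "I \<subseteq> sources" shows "subalgebra M (src I)"
proof -
  have "(\<Union>z\<in>I. source_events M S c B s z) \<subseteq> sets M"
    using indep_sources assms by (auto simp: indep_sets_def)
  from sets.sigma_sets_subset[OF this] show ?thesis
    by (simp add: subalgebra_def space_src sets_src)
qed

lemma measurable_src_mono:
  assumes "I \<subseteq> J" "f \<in> src I \<rightarrow>\<^sub>M N" shows "f \<in> src J \<rightarrow>\<^sub>M N"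
proof (rule measurable_from_subalg[OF _ assms(2)])
  show "subalgebra (src J) (src I)"
    unfolding subalgebra_def space_src sets_src using assms(1) by (simp add: sigma_sets_mono' SUP_subset_mono)
qed

lemma measurable_srcD: "I \<subseteq> sources \<Longrightarrow> f \<in> src I \<rightarrow>\<^sub>M N \<Longrightarrow> f \<in> M \<rightarrow>\<^sub>M N"
  using measurable_from_subalg subalgebra_src by blast

lemma indep_of_src:
  assumes "I \<subseteq> sources" "J \<subseteq> sources" "I \<inter> J = {}" "Y \<in> src J \<rightarrow>\<^sub>M N"
  shows "indep_of (src I) N Y"
proof -
  have "indep_sets (\<lambda>j. sigma_sets (space M) (\<Union>z\<in>case_bool I J j. source_events M S c B s z)) UNIV"
  proof (rule indep_sets_collect_sigma)
    show "indep_sets (source_events M S c B s) (\<Union>j. case_bool I J j)"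
      using assms by (intro indep_sets_mono_index[OF _ indep_sources]) (auto split: bool.splits)
    show "disjoint_family_on (case_bool I J) UNIV"
      using assms by (auto simp: disjoint_family_on_def split: bool.splits)
  qed (rule Int_stable_source_events)
  also have "(\<lambda>j. sigma_sets (space M) (\<Union>z\<in>case_bool I J j. source_events M S c B s z))
      = case_bool (sets (src I)) (sets (src J))"
    by (auto simp: sets_src split: bool.splits)
  finally have "indep_set (sets (src I)) (sets (src J))"
    by (simp add: indep_set_def)
  from indep_setD[OF this] have prob: "prob (A \<inter> C) = prob A * prob C"
    if "A \<in> sets (src I)" "C \<in> sets (src J)" for A C using that .
  have "Y -` C \<inter> space M \<in> sets (src J)" if "C \<in> sets N" for C
    using measurable_sets[OF assms(4) that] by (simp add: space_src)
  with prob assms measurable_srcD subalgebra_src show ?thesis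
    by (auto simp: indep_of_def)
qed

lemma measurable_coin_M: "c k \<in> M \<rightarrow>\<^sub>M count_space UNIV"
  and distr_coin: "distr M (count_space UNIV) (c k) = measure_pmf (bernoulli_pmf p)"
  using sampling by (auto simp: vr_marina_sampling_def)

lemma measurable_minibatch_M: "i \<in> {1..n} \<Longrightarrow> B k i \<in> M \<rightarrow>\<^sub>M count_space UNIV"
  and minibatch_subset: "i \<in> {1..n} \<Longrightarrow> w \<in> space M \<Longrightarrow> set_mset (B k i w) \<subseteq> {1..m}"
  and minibatch_size: "i \<in> {1..n} \<Longrightarrow> w \<in> space M \<Longrightarrow> size (B k i w) = b"
  using sampling by (auto simp: vr_marina_sampling_def)

lemma measurable_seed_M: "i \<in> {1..n} \<Longrightarrow> s k i \<in> M \<rightarrow>\<^sub>M S"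
  and distr_seed: "i \<in> {1..n} \<Longrightarrow> distr M S (s k i) = S"
  using sampling by (auto simp: vr_marina_sampling_def)

lemma source_events_in_src: "z \<in> I \<Longrightarrow> A \<in> source_events M S c B s z \<Longrightarrow> A \<in> sets (src I)"
  by (auto simp: sets_src intro!: sigma_sets.Basic)

lemma measurable_coin: "Coin k \<in> I \<Longrightarrow> c k \<in> src I \<rightarrow>\<^sub>M count_space UNIV"
  by (rule measurableI)
     (simp_all add: space_src, rule source_events_in_src[of "Coin k"], auto simp: source_events_def)

lemma measurable_minibatch: "Minibatch k i \<in> I \<Longrightarrow> B k i \<in> src I \<rightarrow>\<^sub>M count_space UNIV"
  by (rule measurableI)
     (simp_all add: space_src, rule source_events_in_src[of "Minibatch k i"], auto simp: source_events_def)

lemma measurable_seed: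
  assumes "Seed k i \<in> I" "i \<in> {1..n}"
  shows "s k i \<in> src I \<rightarrow>\<^sub>M S"
  using measurable_space[OF measurable_seed_M[OF assms(2)]] assms(1)
  by (intro measurableI)
     (simp_all add: space_src, rule source_events_in_src[of "Seed k i"], auto simp: source_events_def)

lemma gradient_local_measurable:
  "i \<in> {1..n} \<Longrightarrow> gradient (local_obj F m i) \<in> borel_measurable borel"
  by (rule borel_measurable_Lipschitz[of _ "Ls i"]) (use smooth smooth_with_def in blast)

lemma gradient_component_measurable:
  "i \<in> {1..n} \<Longrightarrow> j \<in> {1..m} \<Longrightarrow> gradient (F i j) \<in> borel_measurable borel"
  using F_differentiable borel_measurable_gradient by blast

lemma Q_measurable[measurable]: "(\<lambda>(\<sigma>, x). Q \<sigma> x) \<in> borel_measurable (S \<Otimes>\<^sub>M borel)"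
  using quantization by (simp add: quantization_def)

text \<open>Off the admissible minibatches the kernel is cut off to 0, as nothing is known about \<open>F i j\<close>
  for \<open>j > m\<close>.\<close>

definition batch_kernel :: "nat \<Rightarrow> nat \<Rightarrow> 'w \<Rightarrow> nat multiset \<Rightarrow> real^'d" where
  "batch_kernel k i w J = (if set_mset J \<subseteq> {1..m} \<and> size J = b
     then minibatch_diff F b i J (X k w) (X (Suc k) w) else 0)"

lemma D'_eq_batch_kernel: "i \<in> {1..n} \<Longrightarrow> w \<in> space M \<Longrightarrow> D' k i w = batch_kernel k i w (B k i w)"
  using minibatch_subset minibatch_size by (simp add: D'_def batch_kernel_def)

lemma batch_kernel_measurable:
  assumes "i \<in> {1..n}" "X k \<in> borel_measurable N" "X (Suc k) \<in> borel_measurable N"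
  shows "(\<lambda>(w, J). batch_kernel k i w J) \<in> borel_measurable (N \<Otimes>\<^sub>M count_space UNIV)"
proof (rule measurable_pair_multiset)
  fix J
  show "(\<lambda>w. batch_kernel k i w J) \<in> borel_measurable N"
  proof (cases "set_mset J \<subseteq> {1..m} \<and> size J = b")
    case True
    then have "(\<lambda>w. minibatch_diff F b i J (X k w) (X (Suc k) w)) \<in> borel_measurable N"
      using assms gradient_component_measurable by (intro borel_measurable_minibatch_diff) blast+
    with True show ?thesis unfolding batch_kernel_def by simp
  next
    case False
    then show ?thesis unfolding batch_kernel_def by (simp only: if_False borel_measurable_const)
  qed
qed

lemma D'_measurable_aux:
  assumes "i \<in> {1..n}" "Minibatch k i \<in> I"
    and X[measurable]: "X k \<in> borel_measurable (src I)" "X (Suc k) \<in> borel_measurable (src I)"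
  shows "D' k i \<in> borel_measurable (src I)"
proof -
  note [measurable] = batch_kernel_measurable[OF assms(1) X] measurable_minibatch[OF assms(2)]
  have "(\<lambda>w. batch_kernel k i w (B k i w)) \<in> borel_measurable (src I)" by measurable
  then show ?thesis
    by (rule measurable_cong[THEN iffD2, rotated]) (simp add: space_src D'_eq_batch_kernel[OF assms(1)])
qed

lemma q_measurable_aux:
  assumes "i \<in> {1..n}" "Seed k i \<in> I" and [measurable]: "D' k i \<in> borel_measurable (src I)"
  shows "q k i \<in> borel_measurable (src I)"
proof -
  note [measurable] = measurable_seed[OF assms(2,1)]
  show ?thesis unfolding q_def by measurable
qed

lemma state_measurable_past:
  "X k \<in> borel_measurable (src (past k)) \<and> G k \<in> borel_measurable (src (past k))"
proof (induction k)
  case 0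
  then show ?case by (simp add: X_0 G_0 cong: measurable_cong)
next
  case (Suc k)
  have X[measurable]: "X k \<in> borel_measurable (src (past (Suc k)))"
    and G[measurable]: "G k \<in> borel_measurable (src (past (Suc k)))"
    using Suc measurable_src_mono[OF past_mono[of k "Suc k"]] by auto
  have X'[measurable]: "X (Suc k) \<in> borel_measurable (src (past (Suc k)))"
    unfolding X_Suc by measurable
  have "q k i \<in> borel_measurable (src (past (Suc k)))" if "i \<in> {1..n}" for i
    using that by (intro q_measurable_aux D'_measurable_aux X X') (auto simp: past_def)
  moreover have [measurable]: "c k \<in> src (past (Suc k)) \<rightarrow>\<^sub>M count_space UNIV"
    by (rule measurable_coin) (simp add: past_def)
  moreover note gradient_local_measurable
  ultimately have "G (Suc k) \<in> borel_measurable (src (past (Suc k)))"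
    unfolding G_Suc
    by (intro borel_measurable_scaleR borel_measurable_const borel_measurable_sum measurable_If)
       (auto intro: measurable_compose[OF X'])
  with X' show ?case by simp
qed

context
  fixes k I assumes past: "past k \<subseteq> I"
begin

lemma G_measurable[measurable]: "G k \<in> borel_measurable (src I)"
  using state_measurable_past measurable_src_mono[OF past] by blast

lemma X_measurable[measurable]: "X k \<in> borel_measurable (src I)"
  using state_measurable_past measurable_src_mono[OF past] by blast

lemma X_Suc_measurable[measurable]: "X (Suc k) \<in> borel_measurable (src I)"
  unfolding X_Suc by measurable

lemma D_measurable: assumes "i \<in> {1..n}" shows "D k i \<in> borel_measurable (src I)"
proof -
  note [measurable] = gradient_local_measurable[OF assms]
  show ?thesis unfolding D_def by measurable
qed

lemma D'_measurable: "i \<in> {1..n} \<Longrightarrow> Minibatch k i \<in> I \<Longrightarrow> D' k i \<in> borel_measurable (src I)"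
  by (intro D'_measurable_aux X_measurable X_Suc_measurable)

lemma q_measurable:
  "i \<in> {1..n} \<Longrightarrow> Minibatch k i \<in> I \<Longrightarrow> Seed k i \<in> I \<Longrightarrow> q k i \<in> borel_measurable (src I)"
  by (intro q_measurable_aux D'_measurable)

end

lemma seed_kernel:
  fixes \<psi> :: "'w \<Rightarrow> real^'d"
  assumes i: "i \<in> {1..n}" and I: "I \<subseteq> sources" "Seed k i \<notin> I"
    and \<psi>[measurable]: "\<psi> \<in> borel_measurable (src I)" and sq: "square_integrable M \<psi>"
  shows "square_integrable M (\<lambda>w. Q (s k i w) (\<psi> w) - \<psi> w)"
    and "expectation (\<lambda>w. (norm (Q (s k i w) (\<psi> w) - \<psi> w))\<^sup>2) \<le> \<omega> * expectation (\<lambda>w. (norm (\<psi> w))\<^sup>2)"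
    and "\<lbrakk>u \<in> borel_measurable (src I); square_integrable M u\<rbrakk>
      \<Longrightarrow> expectation (\<lambda>w. u w \<bullet> (Q (s k i w) (\<psi> w) - \<psi> w)) = 0"
proof -
  have indep: "indep_of (src I) S (s k i)"
    using i I by (intro indep_of_src[of _ "{Seed k i}"] measurable_seed) (auto simp: sources_def)
  have h: "(\<lambda>(w, \<sigma>). Q \<sigma> (\<psi> w)) \<in> borel_measurable (src I \<Otimes>\<^sub>M S)" by measurable
  have quant: "integrable S (\<lambda>\<sigma>. Q \<sigma> y)" "(\<integral>\<sigma>. Q \<sigma> y \<partial>S) = y"
    "integrable S (\<lambda>\<sigma>. (norm (Q \<sigma> y - y))\<^sup>2)" "(\<integral>\<sigma>. (norm (Q \<sigma> y - y))\<^sup>2 \<partial>S) \<le> \<omega> * (norm y)\<^sup>2"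
    and "\<omega> > 0" for y
    using quantization by (auto simp: quantization_def)
  have var: "AE w in M. (\<integral>\<^sup>+\<sigma>. ennreal ((norm (Q \<sigma> (\<psi> w) - \<psi> w))\<^sup>2) \<partial>distr M S (s k i))
      \<le> ennreal (\<omega> * (norm (\<psi> w))\<^sup>2)"
    unfolding distr_seed[OF i]
    by (subst nn_integral_eq_integral[OF quant(3)]) (auto intro!: ennreal_leI quant(4))
  have int: "integrable M (\<lambda>w. \<omega> * (norm (\<psi> w))\<^sup>2)"
    using sq by (simp add: square_integrable_def)
  show sq': "square_integrable M (\<lambda>w. Q (s k i w) (\<psi> w) - \<psi> w)"
    by (rule kernel_variance[OF indep h \<psi> var int]) (use \<open>\<omega> > 0\<close> in simp)
  have "expectation (\<lambda>w. (norm (Q (s k i w) (\<psi> w) - \<psi> w))\<^sup>2) \<le> expectation (\<lambda>w. \<omega> * (norm (\<psi> w))\<^sup>2)"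
    by (rule kernel_variance[OF indep h \<psi> var int]) (use \<open>\<omega> > 0\<close> in simp)
  then show "expectation (\<lambda>w. (norm (Q (s k i w) (\<psi> w) - \<psi> w))\<^sup>2) \<le> \<omega> * expectation (\<lambda>w. (norm (\<psi> w))\<^sup>2)"
    by simp
  show "expectation (\<lambda>w. u w \<bullet> (Q (s k i w) (\<psi> w) - \<psi> w)) = 0"
    if "u \<in> borel_measurable (src I)" "square_integrable M u"
  proof (rule kernel_unbiased[OF indep h that _ sq])
    show "square_integrable M (\<lambda>w. Q (s k i w) (\<psi> w))"
      using square_integrable_add[OF sq' sq] by simp
  qed (simp add: distr_seed[OF i] quant)
qed

lemma batch_kernel_moments:
  fixes k
  assumes i: "i \<in> {1..n}"
  defines "P \<equiv> distr M (count_space UNIV) (B k i)"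
  shows "integrable P (batch_kernel k i w)"
    and "AE w in M. (\<integral>J. batch_kernel k i w J \<partial>P) = D k i w"
    and "AE w in M. (\<integral>\<^sup>+J. ennreal ((norm (batch_kernel k i w J - D k i w))\<^sup>2) \<partial>P)
      \<le> ennreal ((ls i)\<^sup>2 / real b * (norm (X (Suc k) w - X k w))\<^sup>2)"
proof -
  interpret P: prob_space P
    unfolding P_def by (rule prob_space_distr) (rule measurable_minibatch_M[OF i])
  show int: "integrable P (batch_kernel k i w)" for w
  proof (rule P.integrable_const_bound)
    define a where "a j = norm (gradient (F i j) (X (Suc k) w) - gradient (F i j) (X k w))" for j
    have "norm (\<Sum>j\<in>#J. gradient (F i j) (X (Suc k) w) - gradient (F i j) (X k w)) \<le> real (size J) * (\<Sum>j=1..m. a j)"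
      if "set_mset J \<subseteq> {1..m}" for J
      using that
    proof (induction J)
      case (add j J)
      have "a j \<le> (\<Sum>j=1..m. a j)"
        using add.prems by (intro member_le_sum) (auto simp: a_def)
      moreover have "norm (\<Sum>j\<in>#J. gradient (F i j) (X (Suc k) w) - gradient (F i j) (X k w)) \<le> real (size J) * (\<Sum>j=1..m. a j)"
        using add by simp
      ultimately have "norm (gradient (F i j) (X (Suc k) w) - gradient (F i j) (X k w))
          + norm (\<Sum>j\<in>#J. gradient (F i j) (X (Suc k) w) - gradient (F i j) (X k w))
          \<le> real (size (add_mset j J)) * (\<Sum>j=1..m. a j)"
        unfolding a_def[of j] by (simp add: algebra_simps)
      then show ?case
        by (simp only: image_mset_add_mset sum_mset.add_mset norm_triangle_le)
    qed simp
    note sum_bound = this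
    have "norm (batch_kernel k i w J) \<le> (\<Sum>j=1..m. a j)" for J
    proof (cases "set_mset J \<subseteq> {1..m} \<and> size J = b")
      case True
      then have "norm (batch_kernel k i w J)
          = norm (\<Sum>j\<in>#J. gradient (F i j) (X (Suc k) w) - gradient (F i j) (X k w)) / real b"
        by (simp add: batch_kernel_def minibatch_diff_def)
      also have "\<dots> \<le> (real b * (\<Sum>j=1..m. a j)) / real b"
        using sum_bound[of J] True by (intro divide_right_mono) auto
      finally show ?thesis using b_pos by simp
    next
      case False
      then show ?thesis by (simp only: batch_kernel_def if_False norm_zero) (simp add: a_def sum_nonneg)
    qed
    then show "AE J in P. norm (batch_kernel k i w J) \<le> (\<Sum>j=1..m. a j)"
      by simp
  qed (simp add: P_def)
  define Z where "Z = (\<lambda>w. (X k w, X (Suc k) w))"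
  define H where "H = vimage_algebra (space M) Z borel"
  have Z_past: "Z \<in> src (past k) \<rightarrow>\<^sub>M borel"
    unfolding Z_def borel_prod[symmetric] using X_measurable X_Suc_measurable by (intro measurable_Pair) auto
  have subH: "subalgebra (src (past k)) H"
    using measurable_sets[OF Z_past] by (auto simp: subalgebra_def H_def sets_vimage_algebra2 space_src)
  have indep: "indep_of H (count_space UNIV) (B k i)"
  proof (rule indep_of_subalgebra[OF indep_of_src subH])
    show "B k i \<in> src {Minibatch k i} \<rightarrow>\<^sub>M count_space UNIV" by (rule measurable_minibatch) simp
  qed (use i past_sources current_notin_past in \<open>auto simp: sources_def\<close>)
  have sub: "subalgebra M H"
    using subH subalgebra_src[OF past_sources, of k] by (auto simp: subalgebra_def)
  have Z[measurable]: "Z \<in> H \<rightarrow>\<^sub>M borel"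
    unfolding H_def by (rule measurable_vimage_algebra1) simp
  have fstZ: "(\<lambda>w. fst (Z w)) \<in> borel_measurable H" and sndZ: "(\<lambda>w. snd (Z w)) \<in> borel_measurable H"
    using Z unfolding borel_prod[symmetric] by measurable
  then have X[measurable]: "X k \<in> borel_measurable H" "X (Suc k) \<in> borel_measurable H"
    by (simp_all add: Z_def cong: measurable_cong)
  note [measurable] = batch_kernel_measurable[OF i X] gradient_local_measurable[OF i]
  have DH[measurable]: "D k i \<in> borel_measurable H" unfolding D_def by measurable
  have avg: "\<And>r. AE w in M. real_cond_exp M H (\<lambda>w. D' k i w $ r) w = D k i w $ r"
    "AE w in M. nn_cond_exp M H (\<lambda>w. ennreal ((norm (D' k i w - D k i w))\<^sup>2)) w
      \<le> ennreal ((ls i)\<^sup>2 / real b * (norm (X (Suc k) w - X k w))\<^sup>2)"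
    using bspec[OF spec[OF average_smooth_X[unfolded average_smooth_def], of k] i]
    unfolding Let_def H_def Z_def D_def D'_def by blast+
  have [measurable]: "(\<lambda>y :: real^'d. y $ r) \<in> borel_measurable borel" for r
    by (intro borel_measurable_continuous_onI continuous_intros)
  have "AE w in M. \<forall>r. (\<integral>J. batch_kernel k i w J $ r \<partial>P) = D k i w $ r"
    unfolding AE_all_countable
  proof
    fix r
    have "AE w in M. (\<integral>J. batch_kernel k i w J $ r \<partial>P) = real_cond_exp M H (\<lambda>w. D' k i w $ r) w"
      unfolding P_def
    proof (rule real_cond_exp_indep_kernel[OF sub indep])
      show "integrable (distr M (count_space UNIV) (B k i)) (\<lambda>J. batch_kernel k i w J $ r)" for w
        using int integrable_bounded_linear[OF bounded_linear_vec_nth, of P "batch_kernel k i w" r]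
        by (simp add: P_def)
      show "(\<lambda>(w, J). batch_kernel k i w J $ r) \<in> borel_measurable (H \<Otimes>\<^sub>M count_space UNIV)"
        by measurable
    qed (use D'_eq_batch_kernel[OF i] in simp)
    with avg(1)[of r] show "AE w in M. (\<integral>J. batch_kernel k i w J $ r \<partial>P) = D k i w $ r"
      by eventually_elim simp
  qed
  then show "AE w in M. (\<integral>J. batch_kernel k i w J \<partial>P) = D k i w"
    by eventually_elim (simp add: vec_eq_iff int flip: integral_bounded_linear[OF bounded_linear_vec_nth])
  have "AE w in M. (\<integral>\<^sup>+J. ennreal ((norm (batch_kernel k i w J - D k i w))\<^sup>2) \<partial>P)
      = nn_cond_exp M H (\<lambda>w. ennreal ((norm (D' k i w - D k i w))\<^sup>2)) w"
    unfolding P_def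
    by (rule nn_cond_exp_indep_kernel[OF sub indep]) (measurable, simp add: D'_eq_batch_kernel[OF i])
  with avg(2) show "AE w in M. (\<integral>\<^sup>+J. ennreal ((norm (batch_kernel k i w J - D k i w))\<^sup>2) \<partial>P)
      \<le> ennreal ((ls i)\<^sup>2 / real b * (norm (X (Suc k) w - X k w))\<^sup>2)"
    by eventually_elim simp
qed

lemma step_norm: "X (Suc k) w - X k w = - (\<gamma> *\<^sub>R G k w)"
  by (simp add: X_Suc)

lemma norm_D_le: "i \<in> {1..n} \<Longrightarrow> norm (D k i w) \<le> Ls i * norm (X (Suc k) w - X k w)"
  using smooth unfolding D_def smooth_with_def by blast

context
  fixes k
  assumes X_sq: "square_integrable M (X k)" and G_sq: "square_integrable M (G k)"
begin

lemma step_square_integrable: "square_integrable M (\<lambda>w. X (Suc k) w - X k w)"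
  unfolding step_norm using square_integrable_scaleR[OF G_sq, of "- \<gamma>"] by simp

lemma X_Suc_square_integrable: "square_integrable M (X (Suc k))"
  unfolding X_Suc using X_sq G_sq by (intro square_integrable_diff square_integrable_scaleR)

lemma D_square_integrable: assumes "i \<in> {1..n}" shows "square_integrable M (D k i)"
proof (rule square_integrable_affine_bound[OF _ step_square_integrable])
  show "finite_measure M" by unfold_locales
  show "D k i \<in> borel_measurable M"
    using D_measurable[OF past_subset_stage assms] measurable_srcD[OF stage_subset_sources] by blast
  show "norm (D k i w) \<le> 0 + Ls i * norm (X (Suc k) w - X k w)" for w
    using norm_D_le[OF assms] by simp
qed

lemma minibatch_deviation:
  assumes i: "i \<in> {1..n}" and I: "past k \<subseteq> I" "I \<subseteq> sources" "Minibatch k i \<notin> I"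
  shows "square_integrable M (\<lambda>w. D' k i w - D k i w)"
    and "expectation (\<lambda>w. (norm (D' k i w - D k i w))\<^sup>2)
      \<le> (ls i)\<^sup>2 / real b * expectation (\<lambda>w. (norm (X (Suc k) w - X k w))\<^sup>2)"
    and "\<lbrakk>u \<in> borel_measurable (src I); square_integrable M u\<rbrakk>
      \<Longrightarrow> expectation (\<lambda>w. u w \<bullet> (D' k i w - D k i w)) = 0"
proof -
  have indep: "indep_of (src I) (count_space UNIV) (B k i)"
    using i I by (intro indep_of_src[of _ "{Minibatch k i}"] measurable_minibatch) (auto simp: sources_def)
  have h: "(\<lambda>(w, J). batch_kernel k i w J) \<in> borel_measurable (src I \<Otimes>\<^sub>M count_space UNIV)"
    using i I by (intro batch_kernel_measurable X_measurable X_Suc_measurable)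
  have D: "D k i \<in> borel_measurable (src I)"
    using I i by (intro D_measurable)
  let ?v = "\<lambda>w. (ls i)\<^sup>2 / real b * (norm (X (Suc k) w - X k w))\<^sup>2"
  have v: "integrable M ?v" "?v w \<ge> 0" for w
    using step_square_integrable by (auto simp: square_integrable_def)
  note var = kernel_variance[OF indep h D batch_kernel_moments(3)[OF i] v]
  have cong: "square_integrable M (\<lambda>w. batch_kernel k i w (B k i w) - D k i w) = square_integrable M (\<lambda>w. D' k i w - D k i w)"
    unfolding square_integrable_def
    by (intro arg_cong2[of _ _ _ _ "(\<and>)"] measurable_cong Bochner_Integration.integrable_cong)
       (simp_all add: D'_eq_batch_kernel[OF i])
  show sq: "square_integrable M (\<lambda>w. D' k i w - D k i w)"
    using var(1) unfolding cong .
  have "expectation (\<lambda>w. (norm (D' k i w - D k i w))\<^sup>2)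
      = expectation (\<lambda>w. (norm (batch_kernel k i w (B k i w) - D k i w))\<^sup>2)"
    by (intro Bochner_Integration.integral_cong) (simp_all add: D'_eq_batch_kernel[OF i])
  with var(2) show "expectation (\<lambda>w. (norm (D' k i w - D k i w))\<^sup>2)
      \<le> (ls i)\<^sup>2 / real b * expectation (\<lambda>w. (norm (X (Suc k) w - X k w))\<^sup>2)" by simp
  assume u: "u \<in> borel_measurable (src I)" "square_integrable M u"
  have "expectation (\<lambda>w. u w \<bullet> (batch_kernel k i w (B k i w) - D k i w)) = 0"
  proof (rule kernel_unbiased[OF indep h u _ D_square_integrable[OF i]])
    show "square_integrable M (\<lambda>w. batch_kernel k i w (B k i w))"
      using square_integrable_add[OF var(1) D_square_integrable[OF i]] by simp
    show "AE w in M. integrable (distr M (count_space UNIV) (B k i)) (batch_kernel k i w)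
        \<and> (\<integral>J. batch_kernel k i w J \<partial>distr M (count_space UNIV) (B k i)) = D k i w"
      using batch_kernel_moments(1,2)[OF i] by simp
  qed
  also have "expectation (\<lambda>w. u w \<bullet> (batch_kernel k i w (B k i w) - D k i w))
      = expectation (\<lambda>w. u w \<bullet> (D' k i w - D k i w))"
    by (intro Bochner_Integration.integral_cong) (simp_all add: D'_eq_batch_kernel[OF i])
  finally show "expectation (\<lambda>w. u w \<bullet> (D' k i w - D k i w)) = 0" .
qed

lemma D'_square_integrable:
  assumes i: "i \<in> {1..n}" shows "square_integrable M (D' k i)"
  using square_integrable_add[OF minibatch_deviation(1)[OF i subset_refl past_sources current_notin_past(2)]
      D_square_integrable[OF i]] by simp

lemma quantization_deviation:
  assumes i: "i \<in> {1..n}" and I: "insert (Minibatch k i) (past k) \<subseteq> I" "I \<subseteq> sources" "Seed k i \<notin> I"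
  shows "square_integrable M (\<lambda>w. q k i w - D' k i w)"
    and "expectation (\<lambda>w. (norm (q k i w - D' k i w))\<^sup>2) \<le> \<omega> * expectation (\<lambda>w. (norm (D' k i w))\<^sup>2)"
    and "\<lbrakk>u \<in> borel_measurable (src I); square_integrable M u\<rbrakk>
      \<Longrightarrow> expectation (\<lambda>w. u w \<bullet> (q k i w - D' k i w)) = 0"
proof -
  have "D' k i \<in> borel_measurable (src I)"
    using i I by (intro D'_measurable) auto
  note seed = seed_kernel[OF i I(2,3) this D'_square_integrable[OF i]]
  show "square_integrable M (\<lambda>w. q k i w - D' k i w)"
    and "expectation (\<lambda>w. (norm (q k i w - D' k i w))\<^sup>2) \<le> \<omega> * expectation (\<lambda>w. (norm (D' k i w))\<^sup>2)"
    unfolding q_def by (fact seed)+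
  show "expectation (\<lambda>w. u w \<bullet> (q k i w - D' k i w)) = 0"
    if "u \<in> borel_measurable (src I)" "square_integrable M u"
    unfolding q_def using that by (rule seed(3))
qed

lemma message_deviation_square_integrable:
  assumes i: "i \<in> {1..n}" shows "square_integrable M (\<lambda>w. q k i w - D k i w)"
proof -
  have "square_integrable M (\<lambda>w. (q k i w - D' k i w) + (D' k i w - D k i w))"
    using i past_sources current_notin_past
    by (intro square_integrable_add minibatch_deviation(1)[of i "past k"]
          quantization_deviation(1)[of i "insert (Minibatch k i) (past k)"]) (auto simp: sources_def)
  then show ?thesis by simp
qed

lemma message_deviation_orthogonal:
  assumes i: "i \<in> {1..n}" and I: "past k \<subseteq> I" "I \<subseteq> sources" "Minibatch k i \<notin> I" "Seed k i \<notin> I"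
    and u: "u \<in> borel_measurable (src I)" "square_integrable M u"
  shows "expectation (\<lambda>w. u w \<bullet> (q k i w - D k i w)) = 0"
proof -
  let ?I = "insert (Minibatch k i) I"
  have I': "insert (Minibatch k i) (past k) \<subseteq> ?I" "?I \<subseteq> sources" "Seed k i \<notin> ?I"
    using I i by (auto simp: sources_def)
  have u': "u \<in> borel_measurable (src ?I)"
    using measurable_src_mono[OF _ u(1)] by blast
  have "expectation (\<lambda>w. u w \<bullet> (q k i w - D k i w))
      = expectation (\<lambda>w. u w \<bullet> (q k i w - D' k i w) + u w \<bullet> (D' k i w - D k i w))"
    by (simp flip: inner_add_right)
  also have "\<dots> = 0"
    using quantization_deviation[OF i I'] minibatch_deviation[OF i I(1,2,3)] u u'
    by (subst Bochner_Integration.integral_add) (auto intro: square_integrable_inner)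
  finally show ?thesis .
qed

lemma message_deviation_variance:
  assumes i: "i \<in> {1..n}"
  shows "expectation (\<lambda>w. (norm (q k i w - D k i w))\<^sup>2)
    \<le> (\<omega> * (Ls i)\<^sup>2 + (1 + \<omega>) * (ls i)\<^sup>2 / real b) * expectation (\<lambda>w. (norm (X (Suc k) w - X k w))\<^sup>2)"
proof -
  let ?I = "insert (Minibatch k i) (past k)"
  have "\<omega> > 0" using quantization by (simp add: quantization_def)
  have I: "?I \<subseteq> ?I" "?I \<subseteq> sources" "Seed k i \<notin> ?I"
    using i past_sources current_notin_past by (auto simp: sources_def)
  note batch = minibatch_deviation[OF i subset_refl past_sources current_notin_past(2)]
  have "expectation (\<lambda>w. (q k i w - D' k i w) \<bullet> (D' k i w - D k i w)) = 0"
    using quantization_deviation(3)[OF i I _ batch(1)] i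
    by (simp add: inner_commute D_measurable D'_measurable borel_measurable_diff subset_insertI)
  then have "expectation (\<lambda>w. (norm ((q k i w - D' k i w) + (D' k i w - D k i w)))\<^sup>2)
      = expectation (\<lambda>w. (norm (q k i w - D' k i w))\<^sup>2) + expectation (\<lambda>w. (norm (D' k i w - D k i w))\<^sup>2)"
    by (intro integral_norm_add_squared_orthogonal quantization_deviation(1)[OF i I] batch(1))
  moreover have "expectation (\<lambda>w. (norm (D k i w + (D' k i w - D k i w)))\<^sup>2)
      = expectation (\<lambda>w. (norm (D k i w))\<^sup>2) + expectation (\<lambda>w. (norm (D' k i w - D k i w))\<^sup>2)"
    using i by (intro integral_norm_add_squared_orthogonal D_square_integrable batch D_measurable) auto
  moreover have "expectation (\<lambda>w. (norm (D k i w))\<^sup>2)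
      \<le> expectation (\<lambda>w. (Ls i)\<^sup>2 * (norm (X (Suc k) w - X k w))\<^sup>2)"
    using D_square_integrable[OF i] step_square_integrable power_mono[OF norm_D_le[OF i], of _ _ 2]
    by (intro integral_mono) (auto simp: square_integrable_def power_mult_distrib)
  ultimately have "expectation (\<lambda>w. (norm (q k i w - D k i w))\<^sup>2)
      \<le> \<omega> * ((Ls i)\<^sup>2 * expectation (\<lambda>w. (norm (X (Suc k) w - X k w))\<^sup>2)
        + expectation (\<lambda>w. (norm (D' k i w - D k i w))\<^sup>2)) + expectation (\<lambda>w. (norm (D' k i w - D k i w))\<^sup>2)"
    using quantization_deviation(2)[OF i I] \<open>\<omega> > 0\<close> mult_left_mono[of _ _ \<omega>] by (fastforce intro: order_trans)
  also have "\<dots> = \<omega> * (Ls i)\<^sup>2 * expectation (\<lambda>w. (norm (X (Suc k) w - X k w))\<^sup>2)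
      + (1 + \<omega>) * expectation (\<lambda>w. (norm (D' k i w - D k i w))\<^sup>2)" by (simp add: algebra_simps)
  also have "\<dots> \<le> \<omega> * (Ls i)\<^sup>2 * expectation (\<lambda>w. (norm (X (Suc k) w - X k w))\<^sup>2)
      + (1 + \<omega>) * ((ls i)\<^sup>2 / real b * expectation (\<lambda>w. (norm (X (Suc k) w - X k w))\<^sup>2))"
    using batch(2) \<open>\<omega> > 0\<close> by (intro add_left_mono mult_left_mono) auto
  finally show ?thesis by (simp add: algebra_simps)
qed

lemma mean_message_deviation:
  fixes u :: "'w \<Rightarrow> real^'d"
  assumes u: "u \<in> borel_measurable (src (past k))" "square_integrable M u"
  defines "v \<equiv> \<lambda>w. (1 / real n) *\<^sub>R (\<Sum>i=1..n. q k i w - D k i w)"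
  shows "square_integrable M (\<lambda>w. u w + v w)"
    and "expectation (\<lambda>w. (norm (u w + v w))\<^sup>2) \<le> expectation (\<lambda>w. (norm (u w))\<^sup>2)
      + (\<omega> * (root_mean_square n Ls)\<^sup>2 + (1 + \<omega>) * (root_mean_square n ls)\<^sup>2 / real b) / real n
        * expectation (\<lambda>w. (norm (X (Suc k) w - X k w))\<^sup>2)"
proof -
  let ?t = "expectation (\<lambda>w. (norm (X (Suc k) w - X k w))\<^sup>2)"
  have dev_sq: "square_integrable M (\<lambda>w. \<Sum>i=1..n. q k i w - D k i w)"
    using message_deviation_square_integrable by (intro square_integrable_sum) auto
  have v_sq: "square_integrable M v"
    unfolding v_def by (rule square_integrable_scaleR[OF dev_sq])
  with u show "square_integrable M (\<lambda>w. u w + v w)" by (intro square_integrable_add)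
  have orth: "expectation (\<lambda>w. (q k i w - D k i w) \<bullet> (q k j w - D k j w)) = 0"
    if ij: "i \<in> {1..n}" "j \<in> {1..n}" "i \<noteq> j" for i j
  proof (rule message_deviation_orthogonal[OF ij(2) _ _ _ _ _ message_deviation_square_integrable[OF ij(1)]])
    let ?I = "insert (Seed k i) (insert (Minibatch k i) (past k))"
    show "past k \<subseteq> ?I" by blast
    then show "(\<lambda>w. q k i w - D k i w) \<in> borel_measurable (src ?I)"
      using ij by (intro borel_measurable_diff q_measurable D_measurable) auto
    show "?I \<subseteq> sources" "Minibatch k j \<notin> ?I" "Seed k j \<notin> ?I"
      using ij past_sources current_notin_past by (auto simp: sources_def)
  qed
  have "expectation (\<lambda>w. u w \<bullet> v w)
      = expectation (\<lambda>w. \<Sum>i=1..n. (1 / real n) * (u w \<bullet> (q k i w - D k i w)))"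
    unfolding v_def inner_scaleR_right inner_sum_right sum_distrib_left ..
  also have "\<dots> = (\<Sum>i=1..n. (1 / real n) * expectation (\<lambda>w. u w \<bullet> (q k i w - D k i w)))"
    using u message_deviation_square_integrable
    by (subst Bochner_Integration.integral_sum) (auto intro!: integrable_mult_right square_integrable_inner)
  also have "\<dots> = 0"
  proof (intro sum.neutral ballI)
    fix i assume "i \<in> {1..n}"
    then have "expectation (\<lambda>w. u w \<bullet> (q k i w - D k i w)) = 0"
      using u past_sources current_notin_past by (intro message_deviation_orthogonal[of i "past k"]) auto
    then show "1 / real n * expectation (\<lambda>w. u w \<bullet> (q k i w - D k i w)) = 0" by simp
  qed
  finally have "expectation (\<lambda>w. (norm (u w + v w))\<^sup>2)
      = expectation (\<lambda>w. (norm (u w))\<^sup>2) + expectation (\<lambda>w. (norm (v w))\<^sup>2)"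
    by (intro integral_norm_add_squared_orthogonal u v_sq)
  moreover have "expectation (\<lambda>w. (norm (v w))\<^sup>2) \<le>
    (\<omega> * (root_mean_square n Ls)\<^sup>2 + (1 + \<omega>) * (root_mean_square n ls)\<^sup>2 / real b) / real n * ?t"
  proof -
    have "expectation (\<lambda>w. (norm (v w))\<^sup>2)
        = (1 / real n)\<^sup>2 * expectation (\<lambda>w. (norm (\<Sum>i=1..n. q k i w - D k i w))\<^sup>2)"
      by (simp add: v_def power_mult_distrib power_divide)
    also have "\<dots> = (1 / real n)\<^sup>2 * (\<Sum>i=1..n. expectation (\<lambda>w. (norm (q k i w - D k i w))\<^sup>2))"
      using message_deviation_square_integrable orth
      by (intro arg_cong[of _ _ "(*) ((1 / real n)\<^sup>2)"] integral_norm_sum_squared_orthogonal) auto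
    also have "\<dots> \<le> (1 / real n)\<^sup>2 * (\<Sum>i=1..n. (\<omega> * (Ls i)\<^sup>2 + (1 + \<omega>) * (ls i)\<^sup>2 / real b) * ?t)"
      by (intro mult_left_mono sum_mono message_deviation_variance) auto
    also have "\<dots> = (\<omega> * (root_mean_square n Ls)\<^sup>2 + (1 + \<omega>) * (root_mean_square n ls)\<^sup>2 / real b) / real n * ?t"
    proof -
      have rms: "(root_mean_square n a)\<^sup>2 = (\<Sum>i=1..n. (a i)\<^sup>2) / real n" for a
        by (simp add: root_mean_square_def sum_nonneg)
      have "(\<Sum>i=1..n. \<omega> * (Ls i)\<^sup>2 + (1 + \<omega>) * (ls i)\<^sup>2 / real b)
          = \<omega> * (\<Sum>i=1..n. (Ls i)\<^sup>2) + (1 + \<omega>) * (\<Sum>i=1..n. (ls i)\<^sup>2) / real b"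
        by (simp add: sum.distrib sum_distrib_left sum_divide_distrib)
      then show ?thesis
        using n_pos b_pos
        by (simp only: sum_distrib_right[symmetric] rms) (simp add: field_simps power2_eq_square)
    qed
    finally show ?thesis .
  qed
  ultimately show "expectation (\<lambda>w. (norm (u w + v w))\<^sup>2) \<le> expectation (\<lambda>w. (norm (u w))\<^sup>2)
      + (\<omega> * (root_mean_square n Ls)\<^sup>2 + (1 + \<omega>) * (root_mean_square n ls)\<^sup>2 / real b) / real n * ?t"
    by linarith
qed

end

lemma coin_expectation:
  fixes a a' :: "'w \<Rightarrow> real"
  assumes "a \<in> borel_measurable (src (stage k))" "a' \<in> borel_measurable (src (stage k))"
    and "integrable M a" "integrable M a'"
  shows "integrable M (\<lambda>w. if c k w then a w else a' w)"
    and "expectation (\<lambda>w. if c k w then a w else a' w) = p * expectation a + (1 - p) * expectation a'"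
proof -
  note [measurable] = measurable_coin_M assms(1,2)
  have [measurable]: "a \<in> borel_measurable M" "a' \<in> borel_measurable M" using assms by auto
  show int: "integrable M (\<lambda>w. if c k w then a w else a' w)"
    by (rule Bochner_Integration.integrable_bound[of _ "\<lambda>w. \<bar>a w\<bar> + \<bar>a' w\<bar>"])
       (use assms in \<open>auto\<close>)
  have indep: "indep_of (src (stage k)) (count_space UNIV) (c k)"
    using stage_subset_sources current_notin_past
    by (intro indep_of_src[of _ "{Coin k}"] measurable_coin) (auto simp: sources_def)
  have "expectation (\<lambda>w. if c k w then a w else a' w)
      = expectation (\<lambda>w. \<integral>y. (if y then a w else a' w) \<partial>distr M (count_space UNIV) (c k))"
    by (rule indep_of_integral[OF indep, where h="\<lambda>w y. if y then a w else a' w"]) (measurable, rule int)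
  also have "\<dots> = expectation (\<lambda>w. p * a w + (1 - p) * a' w)"
    unfolding distr_coin using p_pos p_le by (simp add: mult.commute)
  also have "\<dots> = p * expectation a + (1 - p) * expectation a'"
    using assms by simp
  finally show "expectation (\<lambda>w. if c k w then a w else a' w) = p * expectation a + (1 - p) * expectation a'" .
qed

lemma coin_expectation_const:
  fixes a a' :: real
  shows "integrable M (\<lambda>w. if c k w then a else a')"
    and "expectation (\<lambda>w. if c k w then a else a') = p * a + (1 - p) * a'"
  by (rule coin_expectation(1), simp_all)
     (rule coin_expectation(2)[THEN trans], simp_all add: prob_space)

lemma global_smooth: "smooth_with (root_mean_square n Ls) (global_obj F n m)"
  unfolding global_obj_def[abs_def] using n_pos smooth by (rule smooth_with_mean)

lemma gradient_global:
  "gradient (global_obj F n m) y = (1 / real n) *\<^sub>R (\<Sum>i=1..n. gradient (local_obj F m i) y)"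
  unfolding global_obj_def[abs_def] using smooth
  by (intro gradient_scaled_sum) (auto simp: smooth_with_def)

definition err :: "nat \<Rightarrow> 'w \<Rightarrow> real^'d" where
  "err k w = G k w - gradient (global_obj F n m) (X k w)"

lemma err_Suc:
  "err (Suc k) w = (if c k w then 0 else err k w + (1 / real n) *\<^sub>R (\<Sum>i=1..n. q k i w - D k i w))"
proof (cases "c k w")
  case True
  then show ?thesis by (simp add: err_def G_Suc gradient_global)
next
  case False
  have "(1 / real n) *\<^sub>R (\<Sum>i=1..n. G k w + q k i w) = G k w + (1 / real n) *\<^sub>R (\<Sum>i=1..n. q k i w)"
    using n_pos by (simp add: sum.distrib scaleR_add_right sum_constant_scaleR del: sum_constant)
  with False show ?thesis
    by (simp add: err_def G_Suc gradient_global D_def sum_subtractf scaleR_diff_right)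
qed

lemma gradient_global_measurable: "gradient (global_obj F n m) \<in> borel_measurable borel"
  using global_smooth by (intro borel_measurable_gradient) (simp add: smooth_with_def)

lemma err_measurable: "err k \<in> borel_measurable (src (past k))"
  unfolding err_def using state_measurable_past gradient_global_measurable
  by (auto intro: measurable_compose)

lemma gradient_square_integrable:
  assumes "square_integrable M (X k)"
  shows "square_integrable M (\<lambda>w. gradient (global_obj F n m) (X k w))"
proof (rule square_integrable_affine_bound[OF _ assms])
  show "finite_measure M" by unfold_locales
  show "(\<lambda>w. gradient (global_obj F n m) (X k w)) \<in> borel_measurable M"
    using assms gradient_global_measurable by (auto simp: square_integrable_def)
qed (rule smooth_with_norm_gradient_le[OF global_smooth])

lemma err_recurrence:
  assumes X: "square_integrable M (X k)" and G: "square_integrable M (G k)"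
  shows "square_integrable M (err (Suc k))"
    and "expectation (\<lambda>w. (norm (err (Suc k) w))\<^sup>2) \<le> (1 - p) * (expectation (\<lambda>w. (norm (err k w))\<^sup>2)
      + (\<omega> * (root_mean_square n Ls)\<^sup>2 + (1 + \<omega>) * (root_mean_square n ls)\<^sup>2 / real b) / real n
        * expectation (\<lambda>w. (norm (X (Suc k) w - X k w))\<^sup>2))"
proof -
  let ?e = "\<lambda>w. err k w + (1 / real n) *\<^sub>R (\<Sum>i=1..n. q k i w - D k i w)"
  have "square_integrable M (err k)"
    unfolding err_def by (intro square_integrable_diff G gradient_square_integrable X)
  note dev = mean_message_deviation[OF X G err_measurable this]
  have [measurable]: "?e \<in> borel_measurable (src (stage k))"
    using measurable_src_mono[OF past_subset_stage err_measurable]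
    by (intro borel_measurable_add borel_measurable_scaleR borel_measurable_sum borel_measurable_diff
          borel_measurable_const q_measurable D_measurable) (auto simp: stage_def)
  have eq: "(norm (err (Suc k) w))\<^sup>2 = (if c k w then 0 else (norm (?e w))\<^sup>2)" for w
    by (simp add: err_Suc)
  have e2: "(\<lambda>w. (norm (?e w))\<^sup>2) \<in> borel_measurable (src (stage k))" by measurable
  have e2_int: "integrable M (\<lambda>w. (norm (?e w))\<^sup>2)"
    using dev(1) by (simp add: square_integrable_def)
  note coin = coin_expectation[of "\<lambda>_. 0" k, OF borel_measurable_const e2 integrable_zero e2_int]
  have "err (Suc k) \<in> borel_measurable M"
    by (rule measurable_srcD[OF past_sources err_measurable])
  moreover have "integrable M (\<lambda>w. (norm (err (Suc k) w))\<^sup>2)"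
    unfolding eq by (rule coin(1))
  ultimately show "square_integrable M (err (Suc k))"
    by (simp add: square_integrable_def)
  have "expectation (\<lambda>w. (norm (err (Suc k) w))\<^sup>2) = (1 - p) * expectation (\<lambda>w. (norm (?e w))\<^sup>2)"
    unfolding eq by (simp only: coin(2)) simp
  also have "\<dots> \<le> (1 - p) * (expectation (\<lambda>w. (norm (err k w))\<^sup>2)
      + (\<omega> * (root_mean_square n Ls)\<^sup>2 + (1 + \<omega>) * (root_mean_square n ls)\<^sup>2 / real b) / real n
        * expectation (\<lambda>w. (norm (X (Suc k) w - X k w))\<^sup>2))"
    using dev(2) p_le by (intro mult_left_mono) auto
  finally show "expectation (\<lambda>w. (norm (err (Suc k) w))\<^sup>2) \<le> \<dots>" .
qed

lemma state_square_integrable: "square_integrable M (X k) \<and> square_integrable M (G k)"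
proof (induction k)
  case 0
  show ?case by (simp add: square_integrable_def X_0 G_0 cong: measurable_cong)
next
  case (Suc k)
  then have X: "square_integrable M (X (Suc k))" by (simp add: X_Suc_square_integrable)
  have "square_integrable M (\<lambda>w. err (Suc k) w + gradient (global_obj F n m) (X (Suc k) w))"
    using Suc by (intro square_integrable_add err_recurrence gradient_square_integrable X) auto
  with X show ?case by (simp add: err_def)
qed

lemma err_square_integrable: "square_integrable M (err k)"
  unfolding err_def using state_square_integrable
  by (intro square_integrable_diff gradient_square_integrable) auto

lemma suboptimality_integrable:
  assumes min: "\<And>y. global_obj F n m xs \<le> global_obj F n m y"
  shows "integrable M (\<lambda>w. global_obj F n m (X k w) - global_obj F n m xs)"
proof (rule Bochner_Integration.integrable_bound)
  let ?f = "global_obj F n m"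
  let ?L = "root_mean_square n Ls"
  let ?b = "\<lambda>w. (?f 0 - ?f xs) + (norm (gradient ?f 0))\<^sup>2 + (1 + ?L / 2) * (norm (X k w))\<^sup>2"
  have X: "X k \<in> borel_measurable M" "integrable M (\<lambda>w. (norm (X k w))\<^sup>2)"
    using state_square_integrable by (auto simp: square_integrable_def)
  then show "integrable M ?b" by simp
  have "continuous_on UNIV ?f"
    using global_smooth unfolding smooth_with_def
    by (simp add: differentiable_imp_continuous_on differentiable_at_imp_differentiable_on)
  then have "?f \<in> borel_measurable borel" by (rule borel_measurable_continuous_onI)
  from measurable_compose[OF X(1) this]
  show "(\<lambda>w. ?f (X k w) - ?f xs) \<in> borel_measurable M" by simp
  have "norm (?f (X k w) - ?f xs) \<le> norm (?b w)" for w
  proof -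
    have "?f (X k w) \<le> ?f 0 + gradient ?f 0 \<bullet> X k w + ?L / 2 * (norm (X k w))\<^sup>2"
      using smooth_with_descent[OF global_smooth, of 0 "X k w"] by simp
    also have "gradient ?f 0 \<bullet> X k w \<le> (norm (gradient ?f 0))\<^sup>2 + (norm (X k w))\<^sup>2"
    proof -
      have "0 \<le> (norm (gradient ?f 0 - X k w))\<^sup>2" by simp
      then have "2 * (gradient ?f 0 \<bullet> X k w) \<le> (norm (gradient ?f 0))\<^sup>2 + (norm (X k w))\<^sup>2"
        by (simp add: power2_norm_eq_inner inner_simps inner_commute)
      moreover have "0 \<le> (norm (gradient ?f 0))\<^sup>2 + (norm (X k w))\<^sup>2" by simp
      ultimately show ?thesis by linarith
    qed
    finally have "?f (X k w) - ?f xs \<le> ?b w" by (simp add: algebra_simps)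
    with min[of "X k w"] show ?thesis by simp
  qed
  then show "AE w in M. norm (?f (X k w) - ?f xs) \<le> norm (?b w)" by simp
qed

text \<open>Lyapunov function \<open>f - f(x\<^sup>*) + \<gamma>/p * \<parallel>g - \<nabla>f\<parallel>\<^sup>2\<close>: the step size makes the descent term absorb
  the growth of the estimation error, and \<open>\<gamma> \<mu> \<le> p/2\<close> makes the error contract as fast as
  the function value.\<close>

lemma lyapunov_bound:
  fixes \<mu> :: real and xs :: "real^'d"
  defines "f \<equiv> global_obj F n m" and "L \<equiv> root_mean_square n Ls"
    and "A \<equiv> (\<omega> * (root_mean_square n Ls)\<^sup>2 + (1 + \<omega>) * (root_mean_square n ls)\<^sup>2 / real b) / real n"
  assumes min: "\<And>y. f xs \<le> f y" and pl: "polyak_lojasiewicz \<mu> f xs"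
    and \<gamma>: "0 < \<gamma>" "\<gamma> * \<mu> \<le> p / 2" "\<gamma> * (L + sqrt (2 * (1 - p) / p * A)) \<le> 1"
  shows "expectation (\<lambda>w. f (X k w) - f xs) + \<gamma> / p * expectation (\<lambda>w. (norm (err k w))\<^sup>2)
    \<le> (1 - \<gamma> * \<mu>) ^ k * (f x0 - f xs)"
proof (induction k)
  case 0
  show ?case by (simp add: X_0 G_0 err_def f_def prob_space)
next
  case (Suc k)
  define a where "a = expectation (\<lambda>w. f (X k w) - f xs)"
  define e where "e = expectation (\<lambda>w. (norm (err k w))\<^sup>2)"
  define t where "t = expectation (\<lambda>w. (norm (X (Suc k) w - X k w))\<^sup>2)"
  have "\<omega> > 0" using quantization by (simp add: quantization_def)
  have "A \<ge> 0" unfolding A_def using \<open>\<omega> > 0\<close> by (intro divide_nonneg_nonneg add_nonneg_nonneg mult_nonneg_nonneg) auto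
  have "L \<ge> 0" unfolding L_def root_mean_square_def by (simp add: sum_nonneg)
  have "t \<ge> 0" "e \<ge> 0" unfolding t_def e_def by simp_all
  have int_f: "integrable M (\<lambda>w. f (X k w) - f xs)" for k
    unfolding f_def using min by (intro suboptimality_integrable) (simp add: f_def)
  have int_e: "integrable M (\<lambda>w. (norm (err k w))\<^sup>2)"
    using err_square_integrable by (simp add: square_integrable_def)
  have int_t: "integrable M (\<lambda>w. (norm (X (Suc k) w - X k w))\<^sup>2)"
    using step_square_integrable state_square_integrable by (auto simp: square_integrable_def)
  have "f (X (Suc k) w) - f xs \<le> (1 - \<gamma> * \<mu>) * (f (X k w) - f xs)
      - (1 / (2 * \<gamma>) - L / 2) * (norm (X (Suc k) w - X k w))\<^sup>2 + \<gamma> / 2 * (norm (err k w))\<^sup>2" for w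
  proof -
    have "f (X (Suc k) w) \<le> f (X k w) - \<gamma> / 2 * (norm (gradient f (X k w)))\<^sup>2
        - (1 / (2 * \<gamma>) - L / 2) * (norm (X (Suc k) w - X k w))\<^sup>2 + \<gamma> / 2 * (norm (err k w))\<^sup>2"
      using smooth_with_descent_step[OF global_smooth \<open>0 < \<gamma>\<close>, of "X k w" "G k w"]
      by (simp add: X_Suc err_def f_def L_def)
    moreover have "\<gamma> / 2 * (2 * \<mu> * (f (X k w) - f xs)) \<le> \<gamma> / 2 * (norm (gradient f (X k w)))\<^sup>2"
      using pl \<open>0 < \<gamma>\<close> by (intro mult_left_mono) (auto simp: polyak_lojasiewicz_def)
    ultimately show ?thesis by (simp add: algebra_simps)
  qed
  then have "expectation (\<lambda>w. f (X (Suc k) w) - f xs)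
      \<le> expectation (\<lambda>w. (1 - \<gamma> * \<mu>) * (f (X k w) - f xs)
        - (1 / (2 * \<gamma>) - L / 2) * (norm (X (Suc k) w - X k w))\<^sup>2 + \<gamma> / 2 * (norm (err k w))\<^sup>2)"
    using int_f int_e int_t by (intro integral_mono) auto
  also have "\<dots> = (1 - \<gamma> * \<mu>) * a - (1 / (2 * \<gamma>) - L / 2) * t + \<gamma> / 2 * e"
    using int_f[of k] int_e int_t unfolding a_def t_def e_def
    by (simp only: Bochner_Integration.integral_add Bochner_Integration.integral_diff
        integral_mult_right_zero integrable_mult_right Bochner_Integration.integrable_add Bochner_Integration.integrable_diff)
  finally have descent: "expectation (\<lambda>w. f (X (Suc k) w) - f xs)
      \<le> (1 - \<gamma> * \<mu>) * a - (1 / (2 * \<gamma>) - L / 2) * t + \<gamma> / 2 * e" .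
  have "\<gamma> / p * expectation (\<lambda>w. (norm (err (Suc k) w))\<^sup>2) \<le> \<gamma> / p * ((1 - p) * (e + A * t))"
    using err_recurrence(2)[of k] state_square_integrable[of k] \<gamma> p_pos
    by (intro mult_left_mono) (auto simp: e_def t_def A_def)
  moreover have "\<gamma> / p * ((1 - p) * (e + A * t)) + \<gamma> / 2 * e
      = \<gamma> / p * (1 - p / 2) * e + \<gamma> * (1 - p) / p * A * t"
    using p_pos by (simp add: field_simps)
  moreover have "\<gamma> / p * (1 - p / 2) * e \<le> \<gamma> / p * (1 - \<gamma> * \<mu>) * e"
    using \<gamma> p_pos \<open>e \<ge> 0\<close> by (intro mult_right_mono mult_left_mono) auto
  moreover have "\<gamma> * (1 - p) / p * A * t \<le> (1 / (2 * \<gamma>) - L / 2) * t"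
  proof (rule mult_right_mono[OF _ \<open>t \<ge> 0\<close>])
    define r where "r = sqrt (2 * (1 - p) / p * A)"
    have "2 * (1 - p) / p * A \<ge> 0"
      using p_pos p_le \<open>A \<ge> 0\<close> by (intro mult_nonneg_nonneg divide_nonneg_nonneg) auto
    then have r: "r \<ge> 0" "r\<^sup>2 = 2 * (1 - p) / p * A" by (simp_all add: r_def)
    have "\<gamma> * r \<le> 1 - \<gamma> * L" using \<gamma>(3) by (simp add: r_def algebra_simps)
    moreover have "0 \<le> \<gamma> * r" "0 \<le> \<gamma> * L" using \<gamma>(1) r(1) \<open>L \<ge> 0\<close> by simp_all
    ultimately have "(\<gamma> * r)\<^sup>2 \<le> 1 - \<gamma> * L"
      using power_le_one_iff mult_left_le[of "\<gamma> * r" "\<gamma> * r"] by (simp add: power2_eq_square)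
    then have "2 * \<gamma> * (\<gamma> * (1 - p) / p * A) \<le> 1 - \<gamma> * L"
      by (simp add: power_mult_distrib r(2)) (simp add: power2_eq_square mult_ac)
    then show "\<gamma> * (1 - p) / p * A \<le> 1 / (2 * \<gamma>) - L / 2"
      using \<gamma>(1) by (simp add: field_simps)
  qed
  ultimately have "expectation (\<lambda>w. f (X (Suc k) w) - f xs) + \<gamma> / p * expectation (\<lambda>w. (norm (err (Suc k) w))\<^sup>2)
      \<le> (1 - \<gamma> * \<mu>) * a + \<gamma> / p * (1 - \<gamma> * \<mu>) * e"
    using descent by linarith
  also have "\<dots> = (1 - \<gamma> * \<mu>) * (a + \<gamma> / p * e)" by (simp only: distrib_left mult_ac)
  also have "\<dots> \<le> (1 - \<gamma> * \<mu>) * ((1 - \<gamma> * \<mu>) ^ k * (f x0 - f xs))"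
    using Suc \<gamma> p_le unfolding a_def e_def by (intro mult_left_mono) auto
  finally show ?case by simp
qed

lemma expected_oracle_queries:
  assumes i: "i \<in> {1..n}"
  shows "expectation (\<lambda>w. real (size (oracle_queries m c B X i K w)))
    = real m + real K * (p * real m + 2 * (1 - p) * real b)"
proof -
  have size_sum: "size (\<Sum>k<K. J k) = (\<Sum>k<K. size (J k))" for J :: "nat \<Rightarrow> (nat \<times> real^'d) multiset"
    by (induction K) auto
  have "expectation (\<lambda>w. real (size (oracle_queries m c B X i K w)))
      = expectation (\<lambda>w. real m + (\<Sum>k<K. if c k w then real m else 2 * real b))"
    using minibatch_size[OF i]
    by (intro Bochner_Integration.integral_cong) (auto simp: oracle_queries_def size_sum intro!: sum.cong)
  also have "\<dots> = real m + (\<Sum>k<K. expectation (\<lambda>w. if c k w then real m else 2 * real b))"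
    using coin_expectation_const(1) by (simp add: prob_space)
  also have "\<dots> = real m + real K * (p * real m + 2 * (1 - p) * real b)"
    by (simp add: coin_expectation_const(2))
  finally show ?thesis .
qed

lemma expected_charged_communication:
  "expectation (charged_communication d' z c K) = real d' + real K * (p * real d' + (1 - p) * z)"
proof -
  have "expectation (charged_communication d' z c K)
      = real d' + (\<Sum>k<K. expectation (\<lambda>w. if c k w then real d' else z))"
    unfolding charged_communication_def
    using coin_expectation_const(1) by (simp add: prob_space)
  then show ?thesis by (simp add: coin_expectation_const(2))
qed

lemma nnz_le: "nnz (y :: real^'d) \<le> CARD('d)"
  unfolding nnz_def by (intro card_mono) auto

lemma nnz_measurable: "(\<lambda>y :: real^'d. real (nnz y)) \<in> borel_measurable borel"
proof -
  have "real (nnz y) = (\<Sum>r\<in>UNIV. if y $ r \<noteq> 0 then 1 else 0)" for y :: "real^'d"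
    by (simp add: nnz_def sum.If_cases)
  moreover have [measurable]: "(\<lambda>y :: real^'d. y $ r) \<in> borel_measurable borel" for r
    by (intro borel_measurable_continuous_onI continuous_intros)
  ultimately show ?thesis by simp
qed

lemma nnz_Q_measurable: "(\<lambda>\<sigma>. real (nnz (Q \<sigma> y))) \<in> borel_measurable S"
  using nnz_measurable by measurable

lemma nnz_Q_expectation_le: "(\<integral>\<sigma>. real (nnz (Q \<sigma> y)) \<partial>S) \<le> real CARD('d)"
  using nnz_le nnz_Q_measurable
  by (intro S.integral_le_const S.integrable_const_bound[of _ "real CARD('d)"]) auto

lemma nnz_Q_bdd_above: "bdd_above (range (\<lambda>y. \<integral>\<sigma>. real (nnz (Q \<sigma> y)) \<partial>S))"
  using nnz_Q_expectation_le by (intro bdd_aboveI2)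

lemma expected_density_nonneg: "expected_density S Q \<ge> 0"
  unfolding expected_density_def
  by (rule cSUP_upper2[OF nnz_Q_bdd_above, of 0]) auto

lemma expected_nnz_quantized:
  assumes i: "i \<in> {1..n}"
  shows "expectation (\<lambda>w. real (nnz (q k i w))) \<le> expected_density S Q"
proof -
  let ?I = "insert (Minibatch k i) (past k)"
  have I: "?I \<subseteq> sources" "Seed k i \<notin> ?I"
    using i past_sources current_notin_past by (auto simp: sources_def)
  note [measurable] = D'_measurable[of k ?I i, OF subset_insertI i insertI1] nnz_measurable
  have "indep_of (src ?I) S (s k i)"
    using i I by (intro indep_of_src[of _ "{Seed k i}"] measurable_seed) (auto simp: sources_def)
  moreover have "(\<lambda>(w, \<sigma>). real (nnz (Q \<sigma> (D' k i w)))) \<in> borel_measurable (src ?I \<Otimes>\<^sub>M S)"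
    by measurable
  moreover have "q k i \<in> borel_measurable M"
    using q_measurable[OF past_subset_stage i] i measurable_srcD[OF stage_subset_sources]
    by (auto simp: in_stage)
  then have "integrable M (\<lambda>w. real (nnz (Q (s k i w) (D' k i w))))"
    using nnz_le unfolding q_def
    by (intro integrable_const_bound[of _ "real CARD('d)"]) (auto intro: measurable_compose[OF _ nnz_measurable])
  ultimately have "expectation (\<lambda>w. real (nnz (q k i w)))
      = expectation (\<lambda>w. \<integral>\<sigma>. real (nnz (Q \<sigma> (D' k i w))) \<partial>S)"
    unfolding q_def by (subst indep_of_integral) (auto simp: distr_seed[OF i])
  also have "\<dots> \<le> expected_density S Q"
  proof (rule integral_le_const)
    have "(\<integral>\<sigma>. real (nnz (Q \<sigma> y)) \<partial>S) \<le> expected_density S Q" for y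
      unfolding expected_density_def by (rule cSUP_upper[OF _ nnz_Q_bdd_above]) simp
    then show "AE w in M. (\<integral>\<sigma>. real (nnz (Q \<sigma> (D' k i w))) \<partial>S) \<le> expected_density S Q" by simp
    have "(\<lambda>w. \<integral>\<sigma>. real (nnz (Q \<sigma> (D' k i w))) \<partial>S) \<in> borel_measurable (src ?I)" by measurable
    from measurable_srcD[OF I(1) this]
    show "integrable M (\<lambda>w. \<integral>\<sigma>. real (nnz (Q \<sigma> (D' k i w))) \<partial>S)"
      using nnz_Q_expectation_le by (intro integrable_const_bound[of _ "real CARD('d)"]) auto
  qed
  finally show ?thesis .
qed

lemma expected_transmitted_nonzeros:
  assumes i: "i \<in> {1..n}"
  shows "integrable M (\<lambda>w. real (transmitted_nonzeros F m Q b c B s X i K w))"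
    and "expectation (\<lambda>w. real (transmitted_nonzeros F m Q b c B s X i K w))
      \<le> real CARD('d) + real K * (p * real CARD('d) + (1 - p) * expected_density S Q)"
proof -
  let ?a = "\<lambda>k w. real (nnz (gradient (local_obj F m i) (X (Suc k) w)))"
  let ?z = "\<lambda>k w. real (nnz (q k i w))"
  have eq: "real (transmitted_nonzeros F m Q b c B s X i K w)
      = real (nnz (gradient (local_obj F m i) x0)) + (\<Sum>k<K. if c k w then ?a k w else ?z k w)" for w
    unfolding transmitted_nonzeros_def X_0 q_def D'_def by (auto intro!: sum.cong)
  have a: "?a k \<in> borel_measurable (src (stage k))" and z: "?z k \<in> borel_measurable (src (stage k))" for k
    using X_Suc_measurable[OF past_subset_stage] q_measurable[OF past_subset_stage i] i
    by (auto intro!: measurable_compose[OF _ nnz_measurable]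
        measurable_compose[OF _ gradient_local_measurable[OF i]] simp: in_stage)
  have int: "integrable M (?a k)" "integrable M (?z k)" for k
    using nnz_le measurable_srcD[OF stage_subset_sources a] measurable_srcD[OF stage_subset_sources z]
    by (auto intro!: integrable_const_bound[of _ "real CARD('d)"])
  note coin = coin_expectation[OF a z int]
  show "integrable M (\<lambda>w. real (transmitted_nonzeros F m Q b c B s X i K w))"
    unfolding eq using coin(1) by auto
  have "expectation (\<lambda>w. real (transmitted_nonzeros F m Q b c B s X i K w))
      = real (nnz (gradient (local_obj F m i) x0)) + (\<Sum>k<K. p * expectation (?a k) + (1 - p) * expectation (?z k))"
    unfolding eq using coin by (simp add: prob_space)
  also have "\<dots> \<le> real CARD('d) + (\<Sum>k<K. p * real CARD('d) + (1 - p) * expected_density S Q)"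
  proof (intro add_mono sum_mono mult_left_mono)
    show "expectation (?a k) \<le> real CARD('d)" for k
      using nnz_le by (intro integral_le_const int) auto
  qed (use p_pos p_le nnz_le expected_nnz_quantized[OF i] in auto)
  finally show "expectation (\<lambda>w. real (transmitted_nonzeros F m Q b c B s X i K w))
      \<le> real CARD('d) + real K * (p * real CARD('d) + (1 - p) * expected_density S Q)" by simp
qed

end

lemma iterations_to_accuracy:
  fixes r R \<Delta> \<epsilon> :: real
  assumes "0 < r" "r \<le> 1" "1 / r \<le> 2 * R" "1 \<le> R" "0 < \<epsilon>"
  shows "\<exists>K. (1 - r) ^ K * \<Delta> \<le> \<epsilon> \<and> (\<epsilon> \<le> \<Delta> / 2 \<longrightarrow> real K \<le> 4 * (R * ln (\<Delta> / \<epsilon>)))"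
proof (cases "\<Delta> \<le> \<epsilon>")
  case True
  with \<open>0 < \<epsilon>\<close> show ?thesis by (intro exI[of _ 0]) auto
next
  case False
  define l where "l = ln (\<Delta> / \<epsilon>)"
  have "l > 0" using False \<open>0 < \<epsilon>\<close> by (simp add: l_def)
  define K where "K = nat \<lceil>l / r\<rceil>"
  have K: "l / r \<le> real K" "real K \<le> l / r + 1"
    using \<open>l > 0\<close> \<open>0 < r\<close> by (simp_all add: K_def)
  have "(1 - r) ^ K \<le> exp (- r) ^ K"
    using exp_ge_add_one_self[of "- r"] \<open>r \<le> 1\<close> by (intro power_mono) auto
  also have "\<dots> = exp (- (r * real K))" by (simp flip: exp_of_nat_mult)
  also have "\<dots> \<le> exp (- l)" using K(1) \<open>0 < r\<close> by (simp add: field_simps)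
  also have "\<dots> = \<epsilon> / \<Delta>" using False \<open>0 < \<epsilon>\<close> by (simp add: l_def exp_minus)
  finally have "(1 - r) ^ K * \<Delta> \<le> \<epsilon>" using False \<open>0 < \<epsilon>\<close> by (simp add: field_simps)
  moreover have "real K \<le> 4 * (R * l)" if "\<epsilon> \<le> \<Delta> / 2"
  proof -
    have "ln (1 / 2) \<le> (1 / 2 :: real) - 1" by (rule ln_le_minus_one) simp
    then have "1 / 2 \<le> ln (2 :: real)" by (simp add: ln_div)
    also have "\<dots> \<le> l" using that \<open>0 < \<epsilon>\<close> by (simp add: l_def field_simps)
    finally have "1 \<le> 2 * (R * l)"
      using mult_mono[of 1 R "1 / 2" l] \<open>1 \<le> R\<close> by simp
    moreover have "l / r \<le> 2 * (R * l)"
      using mult_right_mono[OF assms(3), of l] \<open>l > 0\<close> by simp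
    ultimately show ?thesis using K(2) by linarith
  qed
  ultimately show ?thesis by (auto simp: l_def)
qed

theorem theoremD2:
  fixes F :: "nat \<Rightarrow> nat \<Rightarrow> real^'d \<Rightarrow> real"
    and n m b :: nat
    and x0 xs :: "real^'d"
    and \<gamma> p \<mu> \<omega> :: real
    and Ls ls :: "nat \<Rightarrow> real"
    and S :: "'s measure" and Q :: "'s \<Rightarrow> real^'d \<Rightarrow> real^'d"
    and M :: "'w measure"
    and c :: "nat \<Rightarrow> 'w \<Rightarrow> bool"
    and B :: "nat \<Rightarrow> nat \<Rightarrow> 'w \<Rightarrow> nat multiset"
    and s :: "nat \<Rightarrow> nat \<Rightarrow> 'w \<Rightarrow> 's"
    and f :: "real^'d \<Rightarrow> real" and x :: "nat \<Rightarrow> 'w \<Rightarrow> real^'d"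
    and d :: nat and L l \<zeta> \<Delta>0 R :: real and stepmax :: ereal
  assumes f_def: "f = global_obj F n m"
    and x_def: "x = (\<lambda>k w. fst (vr_marina F n m Q x0 \<gamma> b c B s k w))"
    and d_def: "d = CARD('d)"
    and L_def: "L = root_mean_square n Ls"
    and l_def: "l = root_mean_square n ls"
    and zeta_def: "\<zeta> = expected_density S Q"
    and Delta0_def: "\<Delta>0 = f x0 - f xs"
    and stepmax_def: "stepmax = min
           (1 / ereal (L + sqrt (2 * (1 - p) / (p * real n) *
              (\<omega> * L\<^sup>2 + (1 + \<omega>) * l\<^sup>2 / real b))))
           (ereal (p / (2 * \<mu>)))"
    and R_def: "R = max (1 / p)
           ((L + sqrt ((1 - p) / (p * real n) *
              (\<omega> * L\<^sup>2 + (1 + \<omega>) * l\<^sup>2 / real b))) / \<mu>)"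
    and "n \<ge> 1" and "m \<ge> 1" and "b \<ge> 1"
    and "\<And>i j y. i \<in> {1..n} \<Longrightarrow> j \<in> {1..m} \<Longrightarrow> F i j differentiable (at y)"
    and "\<exists>fstar. \<forall>y. f y \<ge> fstar"
    and "\<And>i. i \<in> {1..n} \<Longrightarrow> smooth_with (Ls i) (local_obj F m i)"
    and "\<And>y. f xs \<le> f y"
    and "polyak_lojasiewicz \<mu> f xs"
    and "quantization S Q \<omega>"
    and "0 < p" and "p \<le> 1"
    and "vr_marina_sampling M S n m b p c B s"
    and "average_smooth M F n m b B x ls"
    and "0 < \<gamma>" and "ereal \<gamma> \<le> stepmax"
  shows "(\<forall>K. integrable M (\<lambda>w. f (x K w) - f xs) \<and>
              (\<integral>w. f (x K w) - f xs \<partial>M) \<le> (1 - \<gamma> * \<mu>) ^ K * \<Delta>0) \<and>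
         (\<forall>K. \<forall>i\<in>{1..n}.
              (\<integral>w. real (size (oracle_queries m c B x i K w)) \<partial>M)
                = real m + real K * (p * real m + 2 * (1 - p) * real b)) \<and>
         (\<forall>K. (\<integral>w. charged_communication d \<zeta> c K w \<partial>M)
                = real d + real K * (p * real d + (1 - p) * \<zeta>)) \<and>
         (\<forall>K. \<forall>i\<in>{1..n}.
              integrable M (\<lambda>w. real (transmitted_nonzeros F m Q b c B s x i K w)) \<and>
              (\<integral>w. real (transmitted_nonzeros F m Q b c B s x i K w) \<partial>M)
                \<le> real d + real K * (p * real d + (1 - p) * \<zeta>)) \<and>
         (ereal \<gamma> = stepmax \<longrightarrow>
           (\<forall>\<epsilon>>0. \<exists>K. (\<integral>w. f (x K w) - f xs \<partial>M) \<le> \<epsilon> \<and>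
              (\<epsilon> \<le> \<Delta>0 / 2 \<longrightarrow>
                 real K \<le> 8 * (R * ln (\<Delta>0 / \<epsilon>)) \<and>
                 real m + real K * (p * real m + 2 * (1 - p) * real b)
                   \<le> 8 * (real m + R * (p * real m + (1 - p) * real b) * ln (\<Delta>0 / \<epsilon>)) \<and>
                 real d + real K * (p * real d + (1 - p) * \<zeta>)
                   \<le> 8 * (real d + R * (p * real d + (1 - p) * \<zeta>) * ln (\<Delta>0 / \<epsilon>)))))"
proof -
  interpret run: vr_marina_run F n m b x0 \<gamma> p \<omega> Ls ls S Q M c B s
    using assms by unfold_locales auto
  have x_eq: "x = run.X" by (simp add: x_def run.X_def fun_eq_iff)
  define C where "C = (1 - p) / (p * real n) * (\<omega> * L\<^sup>2 + (1 + \<omega>) * l\<^sup>2 / real b)"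
  define T where "T = L + sqrt (2 * C)"
  have "\<mu> > 0" using \<open>polyak_lojasiewicz \<mu> f xs\<close> by (simp add: polyak_lojasiewicz_def)
  have "\<omega> > 0" using \<open>quantization S Q \<omega>\<close> by (simp add: quantization_def)
  have "C \<ge> 0"
    unfolding C_def using \<open>0 < p\<close> \<open>p \<le> 1\<close> \<open>\<omega> > 0\<close>
    by (intro mult_nonneg_nonneg divide_nonneg_nonneg add_nonneg_nonneg) auto
  have "L \<ge> 0" by (simp add: L_def root_mean_square_def sum_nonneg)
  have "T \<ge> 0" using \<open>C \<ge> 0\<close> \<open>L \<ge> 0\<close> by (simp add: T_def)
  have stepmax: "stepmax = min (1 / ereal T) (ereal (p / (2 * \<mu>)))"
    unfolding stepmax_def T_def C_def by (simp only: mult.assoc times_divide_eq_right times_divide_eq_left)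
  have R: "R = max (1 / p) ((L + sqrt C) / \<mu>)" by (simp add: R_def C_def)
  have inverse_T: "1 / ereal T = (if T = 0 then \<infinity> else ereal (1 / T))"
    by (simp add: one_ereal_def zero_ereal_def)
  have "\<gamma> \<le> p / (2 * \<mu>)" using \<open>ereal \<gamma> \<le> stepmax\<close> by (simp add: stepmax)
  then have \<gamma>\<mu>: "\<gamma> * \<mu> \<le> p / 2" using \<open>\<mu> > 0\<close> by (simp add: field_simps)
  have \<gamma>T: "\<gamma> * T \<le> 1"
    using \<open>ereal \<gamma> \<le> stepmax\<close> \<open>T \<ge> 0\<close> by (cases "T = 0") (auto simp: stepmax inverse_T field_simps)
  have T_eq: "2 * (1 - p) / p * ((\<omega> * L\<^sup>2 + (1 + \<omega>) * l\<^sup>2 / real b) / real n) = 2 * C"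
    by (simp add: C_def)
  have int: "integrable M (\<lambda>w. f (x K w) - f xs)" for K
    unfolding x_eq f_def using \<open>\<And>y. f xs \<le> f y\<close> by (intro run.suboptimality_integrable) (simp add: f_def)
  have rate: "(\<integral>w. f (x K w) - f xs \<partial>M) \<le> (1 - \<gamma> * \<mu>) ^ K * \<Delta>0" for K
  proof -
    have "(\<integral>w. f (run.X K w) - f xs \<partial>M) + \<gamma> / p * (\<integral>w. (norm (run.err K w))\<^sup>2 \<partial>M)
        \<le> (1 - \<gamma> * \<mu>) ^ K * \<Delta>0"
      unfolding Delta0_def f_def
    proof (rule run.lyapunov_bound)
      show "\<gamma> * (root_mean_square n Ls + sqrt (2 * (1 - p) / p * ((\<omega> * (root_mean_square n Ls)\<^sup>2
          + (1 + \<omega>) * (root_mean_square n ls)\<^sup>2 / real b) / real n))) \<le> 1"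
        using \<gamma>T unfolding T_def L_def[symmetric] l_def[symmetric] T_eq .
    qed (use assms \<gamma>\<mu> in \<open>simp_all add: f_def\<close>)
    moreover have "0 \<le> \<gamma> / p * (\<integral>w. (norm (run.err K w))\<^sup>2 \<partial>M)"
      using \<open>0 < \<gamma>\<close> \<open>0 < p\<close> by (intro mult_nonneg_nonneg) auto
    ultimately show ?thesis by (simp add: x_eq)
  qed
  have complexity: "\<exists>K. (\<integral>w. f (x K w) - f xs \<partial>M) \<le> \<epsilon> \<and>
      (\<epsilon> \<le> \<Delta>0 / 2 \<longrightarrow>
         real K \<le> 8 * (R * ln (\<Delta>0 / \<epsilon>)) \<and>
         real m + real K * (p * real m + 2 * (1 - p) * real b)
           \<le> 8 * (real m + R * (p * real m + (1 - p) * real b) * ln (\<Delta>0 / \<epsilon>)) \<and>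
         real d + real K * (p * real d + (1 - p) * \<zeta>)
           \<le> 8 * (real d + R * (p * real d + (1 - p) * \<zeta>) * ln (\<Delta>0 / \<epsilon>)))"
    if "ereal \<gamma> = stepmax" "\<epsilon> > 0" for \<epsilon>
  proof -
    have "R \<ge> 1" using \<open>0 < p\<close> \<open>p \<le> 1\<close> by (simp add: R le_max_iff_disj)
    have "1 / (\<gamma> * \<mu>) \<le> 2 * R"
    proof (cases "stepmax = ereal (p / (2 * \<mu>))")
      case True
      then have "\<gamma> = p / (2 * \<mu>)" using that by simp
      then have "1 / (\<gamma> * \<mu>) = 2 * (1 / p)" using \<open>\<mu> > 0\<close> by simp
      then show ?thesis by (simp add: R)
    next
      case False
      then have "stepmax = 1 / ereal T" by (auto simp: stepmax min_def)
      with that have "T \<noteq> 0" "\<gamma> = 1 / T" by (auto simp: inverse_T split: if_splits)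
      then have "1 / (\<gamma> * \<mu>) = T / \<mu>" by simp
      also have "T \<le> 2 * (L + sqrt C)"
      proof -
        have "sqrt 2 \<le> 2" by (rule real_le_lsqrt) auto
        then have "sqrt (2 * C) \<le> 2 * sqrt C"
          unfolding real_sqrt_mult using \<open>C \<ge> 0\<close> by (intro mult_right_mono) auto
        then show ?thesis using \<open>L \<ge> 0\<close> by (simp add: T_def)
      qed
      then have "T / \<mu> \<le> 2 * ((L + sqrt C) / \<mu>)"
        using \<open>\<mu> > 0\<close> by (simp add: divide_right_mono)
      also have "\<dots> \<le> 2 * R" unfolding R by (intro mult_left_mono) auto
      finally show ?thesis .
    qed
    moreover have "0 < \<gamma> * \<mu>" "\<gamma> * \<mu> \<le> 1" using \<open>0 < \<gamma>\<close> \<open>\<mu> > 0\<close> \<gamma>\<mu> \<open>p \<le> 1\<close> by auto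
    ultimately obtain K where K: "(1 - \<gamma> * \<mu>) ^ K * \<Delta>0 \<le> \<epsilon>"
      "\<epsilon> \<le> \<Delta>0 / 2 \<Longrightarrow> real K \<le> 4 * (R * ln (\<Delta>0 / \<epsilon>))"
      using iterations_to_accuracy[of "\<gamma> * \<mu>" R \<epsilon> \<Delta>0] \<open>R \<ge> 1\<close> \<open>\<epsilon> > 0\<close> by blast
    have cost: "a + real K * u \<le> 8 * (a + R * v * ln (\<Delta>0 / \<epsilon>))"
      if "\<epsilon> \<le> \<Delta>0 / 2" "0 \<le> a" "0 \<le> u" "u \<le> 2 * v" for a u v
    proof -
      have "real K * u \<le> 4 * (R * ln (\<Delta>0 / \<epsilon>)) * (2 * v)"
        using K(2)[OF that(1)] that by (intro mult_mono) auto
      with that show ?thesis by (simp add: algebra_simps)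
    qed
    have "\<zeta> \<ge> 0" unfolding zeta_def by (rule run.expected_density_nonneg)
    have "real K \<le> 8 * (R * ln (\<Delta>0 / \<epsilon>))" if "\<epsilon> \<le> \<Delta>0 / 2"
      using cost[of 0 1 1] that by simp
    moreover have "real m + real K * (p * real m + 2 * (1 - p) * real b)
        \<le> 8 * (real m + R * (p * real m + (1 - p) * real b) * ln (\<Delta>0 / \<epsilon>))" if "\<epsilon> \<le> \<Delta>0 / 2"
    proof (rule cost[OF that])
      have "0 \<le> p * real m" using \<open>0 < p\<close> by simp
      then show "p * real m + 2 * (1 - p) * real b \<le> 2 * (p * real m + (1 - p) * real b)"
        by (simp add: algebra_simps)
    qed (use \<open>0 < p\<close> \<open>p \<le> 1\<close> in auto)
    moreover have "real d + real K * (p * real d + (1 - p) * \<zeta>)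
        \<le> 8 * (real d + R * (p * real d + (1 - p) * \<zeta>) * ln (\<Delta>0 / \<epsilon>))" if "\<epsilon> \<le> \<Delta>0 / 2"
      using that \<open>0 < p\<close> \<open>p \<le> 1\<close> \<open>\<zeta> \<ge> 0\<close> by (intro cost) auto
    ultimately show ?thesis using order_trans[OF rate K(1)] by blast
  qed
  show ?thesis
    using int rate complexity run.expected_oracle_queries run.expected_charged_communication
      run.expected_transmitted_nonzeros
    unfolding x_eq d_def zeta_def by blast
qed

end
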